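(* Let $\pi\in\mathcal P(\mathcal X)$, let $\mathcal B=\{P_1,\dots,P_n\}\subset\mathcal L(\mathcal X)$ be a family of $\pi$-stationary transition matrices, and let $\mathbf S=(S_1,\dots,S_m)$ be a partition of $[d]$. With $\mathcal F=\mathcal F(\mathbf S)$, $\mathcal A$, $\widetilde D_{\mathrm{KL}}^\pi$, $A_n^*(\mathbf w)$, the primal problem and the dual problem as defined in the context: 1. Strong duality holds for the primal problem, and there exists $\mathbf w^*\in\mathcal S_n$ such that $$\min_{A\in\mathcal A}\max_{P\in\mathcal B}\widetilde D_{\mathrm{KL}}^\pi(P\|A)=\max_{\mathbf w\in\mathcal S_n}\sum_{i=1}^nw_i\widetilde D_{\mathrm{KL}}^\pi(P_i\|A_n^*(\mathbf w))=\sum_{i=1}^nw_i^*\widetilde D_{\mathrm{KL}}^\pi(P_i\|A_n^*(\mathbf w^* )).$$ 2. If the pair $(A,r)\in\mathcal A\times\mathbb R_+$ minimizes the primal problem and $\mathbf w^*\in\mathcal S_n$ maximizes the dual problem, then for every $i\in\{1,\dots,n\}$: $\widetilde D_{\mathrm{KL}}^\pi(P_i\|A)=r$ if $w_i^*>0$, and $\widetilde D_{\mathrm{KL}}^\pi(P_i\|A)\le r$ if $w_i^*=0$. 3. $\displaystyle\min_{Q\in\mathcal F}\max_{P\in\mathcal B}D_{\mathrm{KL}}^\pi(P\|Q)=\min_{A\in\mathcal A}\max_{P\in\mathcal B}\widetilde D_{\mathrm{KL}}^\pi(P\|A).$ 4. The same $\mathbf w^*\in\mathcal S_n$ as in item 1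 satisfies $$\min_{Q\in\mathcal F}\max_{P\in\mathcal B}D_{\mathrm{KL}}^\pi(P\|Q)=\max_{\mathbf w\in\mathcal S_n}\sum_{i=1}^nw_iD_{\mathrm{KL}}^\pi\big(P_i\|\otimes_{k=1}^m\overline P(\mathbf w)^{(S_k)}\big)=\sum_{i=1}^nw_i^*D_{\mathrm{KL}}^\pi\big(P_i\|\otimes_{k=1}^m\overline P(\mathbf w^* )^{(S_k)}\big).$$ 5. The map $\mathcal S_n\ni\mathbf w\mapsto\sum_{i=1}^nw_iD_{\mathrm{KL}}^\pi\big(P_i\|\otimes_{k=1}^m\overline P(\mathbf w)^{(S_k)}\big)$ is concave in $\mathbf w$.
   Context: $[d]=\{1,\dots,d\}$; $\mathcal X=\mathcal X^{(1)}\times\cdots\times\mathcal X^{(d)}$ is a finite product state space; for $S\subseteq[d]$, $\mathcal X^{(S)}=\times_{i\in S}\mathcal X^{(i)}$, $-S=[d]\setminus S$. $\mathcal L(\mathcal Y)$ is the set of transition matrices on $\mathcal Y$. $\mathcal P(\mathcal X)$ is the set of probability mass functions on $\mathcal X$ with full support. $P$ is $\pi$-stationary if $\pi P=\pi$. $\mathcal S_n=\{\mathbf w\in\mathbb R_+^n:\sum_iw_i=1\}$, and $\overline P(\mathbf w)=\sum_{i=1}^nw_iP_i$. For $P\in\mathcal L(\mathcal X)$, the keep-$S$-in matrix with respect to $\pi$ is $P^{(S)}\in\mathcal L(\mathcal X^{(S)})$, $$P^{(S)}(x^{(S)},y^{(S)})=\frac{\sum_{x^{(-S)},y^{(-S)}}\pi(x)P(x,y)}{\sum_{x^{(-S)}}\pi(x)},\qquad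 P^{(\emptyset)}=1.$$ $(\otimes_{j=1}^mM_j)(x,y)=\prod_jM_j(x^{(S_j)},y^{(S_j)})$. $D_{\mathrm{KL}}^{\pi}(M\|L)=\sum_x\pi(x)\sum_yM(x,y)\ln\frac{M(x,y)}{L(x,y)}$, with $0\ln\frac0a:=0$ for $a\in[0,1]$, $b\ln\frac b0:=+\infty$ for $b>0$, $0\cdot(\pm\infty):=0$. $\mathcal F(\mathbf S)=\{Q\in\mathcal L(\mathcal X):Q=Q^{(S_1)}\otimes\cdots\otimes Q^{(S_m)}\}$. $\mathcal A$ is the set of $\mathcal X\times\mathcal X$ matrices $A$ (entries in $[-\infty,\infty)$, $\log0=-\infty$) for which there exist $l\in\mathbb N$, $\mathbf c\in\mathcal S_l$, $Q_1,\dots,Q_l\in\mathcal F$ with $A(x,y)=\sum_{i=1}^lc_i\log Q_i(x,y)$ for all $x,y$. Generalized KL divergence: $\widetilde D_{\mathrm{KL}}^\pi(P\|A)=\sum_{x,y}\pi(x)P(x,y)\log P(x,y)-\sum_{x,y}\pi(x)P(x,y)A(x,y)$ for $P\in\mathcal L(\mathcal X)$, $A\in\mathcal A$. $A_n^*(\mathbf w)\in\mathcal A$ is the matrix with entries $A_n^*(\mathbf w)(x,y)=\log\big((\otimes_{j=1}^m\overline P(\mathbf w)^{(S_j)})(x,y)\big)$. Primal problem: minimize $r$ over $A\in\mathcal A$, $r\in\mathbb R_+$ subject to $\widetilde D_{\mathrm{KL}}^\pi(P_i\|A)\le r$ for all $i\in\{1,\dots,n\}$; its value is $\min_{A\in\mathcal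 A}\max_{P\in\mathcal B}\widetilde D_{\mathrm{KL}}^\pi(P\|A)$. Dual problem: with Lagrangian $L(r,A,\mathbf w)=r+\sum_{i=1}^nw_i(\widetilde D_{\mathrm{KL}}^\pi(P_i\|A)-r)$, $$\max_{\mathbf w\in\mathbb R_+^n}\min_{r\ge0,A\in\mathcal A}L(r,A,\mathbf w)=\max_{\mathbf w\in\mathcal S_n}\min_{A\in\mathcal A}\sum_{i=1}^nw_i\widetilde D_{\mathrm{KL}}^\pi(P_i\|A)=\max_{\mathbf w\in\mathcal S_n}\sum_{i=1}^nw_i\widetilde D_{\mathrm{KL}}^\pi(P_i\|A_n^*(\mathbf w)).$$ Strong duality means that primal and dual optimal values coincide. *)

theory Defs
  imports "HOL-Analysis.Analysis"
begin

text \<open>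
  A state is a tuple of coordinates, so the product space over a set of coordinates \<open>S\<close> is
  \<open>Pi\<^sub>E S Xs\<close>, and the projection \<open>x \<mapsto> x\<^sup>(\<^sup>S\<^sup>)\<close> is \<open>restrict x S\<close>. A matrix on \<open>Y\<close> is a binary
  function of which only the values on \<open>Y \<times> Y\<close> matter.
\<close>

type_synonym 'a state = "nat \<Rightarrow> 'a"
type_synonym ('s, 'v) matrix = "'s \<Rightarrow> 's \<Rightarrow> 'v"

definition transition_matrices :: "'s set \<Rightarrow> ('s, real) matrix set" where
  "transition_matrices Y =
     {M. (\<forall>x\<in>Y. \<forall>y\<in>Y. 0 \<le> M x y) \<and> (\<forall>x\<in>Y. (\<Sum>y\<in>Y. M x y) = 1)}"

definition full_support_pmfs :: "'s set \<Rightarrow> ('s \<Rightarrow> real) set" where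
  "full_support_pmfs Y = {\<pi>. (\<forall>x\<in>Y. 0 < \<pi> x) \<and> (\<Sum>x\<in>Y. \<pi> x) = 1}"

definition stationary :: "'s set \<Rightarrow> ('s \<Rightarrow> real) \<Rightarrow> ('s, real) matrix \<Rightarrow> bool" where
  "stationary Y \<pi> M \<longleftrightarrow> (\<forall>y\<in>Y. (\<Sum>x\<in>Y. \<pi> x * M x y) = \<pi> y)"

definition prob_weights :: "'i set \<Rightarrow> ('i \<Rightarrow> real) set" where
  "prob_weights I = {c. (\<forall>i\<in>I. 0 \<le> c i) \<and> (\<Sum>i\<in>I. c i) = 1}"

definition prob_simplex :: "(real ^ 'n) set" where
  "prob_simplex = {w. vec_nth w \<in> prob_weights UNIV}"

definition mixture :: "('n \<Rightarrow> ('s, real) matrix) \<Rightarrow> real ^ 'n \<Rightarrow> ('s, real) matrix" where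
  "mixture P w = (\<lambda>x y. \<Sum>i\<in>UNIV. w $ i * P i x y)"

text \<open>
  The keep-\<open>S\<close>-in matrix. Summing over the coordinates outside \<open>S\<close> with those in \<open>S\<close> held fixed
  is summing over a fibre of the projection. For \<open>S = {}\<close> the only index is the empty tuple, and
  for a transition matrix \<open>M\<close> the entry is \<open>1\<close>.
\<close>
definition keep_in ::
  "'a state set \<Rightarrow> ('a state \<Rightarrow> real) \<Rightarrow> nat set \<Rightarrow> ('a state, real) matrix \<Rightarrow> ('a state, real) matrix"
  where
  "keep_in X \<pi> S M = (\<lambda>u v.
     (\<Sum>x\<in>{x\<in>X. restrict x S = u}. \<Sum>y\<in>{y\<in>X. restrict y S = v}. \<pi> x * M x y) /
     (\<Sum>x\<in>{x\<in>X. restrict x S = u}. \<pi> x))"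

definition tensor ::
  "nat \<Rightarrow> (nat \<Rightarrow> nat set) \<Rightarrow> (nat \<Rightarrow> ('a state, real) matrix) \<Rightarrow> ('a state, real) matrix" where
  "tensor m Ss M = (\<lambda>x y. \<Prod>j=1..m. M j (restrict x (Ss j)) (restrict y (Ss j)))"

definition factor_product ::
  "'a state set \<Rightarrow> ('a state \<Rightarrow> real) \<Rightarrow> nat \<Rightarrow> (nat \<Rightarrow> nat set) \<Rightarrow>
   ('a state, real) matrix \<Rightarrow> ('a state, real) matrix" where
  "factor_product X \<pi> m Ss M = tensor m Ss (\<lambda>j. keep_in X \<pi> (Ss j) M)"

definition factorizable ::
  "'a state set \<Rightarrow> ('a state \<Rightarrow> real) \<Rightarrow> nat \<Rightarrow> (nat \<Rightarrow> nat set) \<Rightarrow> ('a state, real) matrix set" where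
  "factorizable X \<pi> m Ss =
     {Q \<in> transition_matrices X. \<forall>x\<in>X. \<forall>y\<in>X. Q x y = factor_product X \<pi> m Ss Q x y}"

text \<open>The logarithm on \<open>[0, \<infinity>)\<close> with \<open>log 0 = -\<infinity>\<close>; recall that \<open>0 * (\<plusminus>\<infinity>) = 0\<close> in \<^typ>\<open>ereal\<close>.\<close>
definition elog :: "real \<Rightarrow> ereal" where
  "elog a = (if a = 0 then - \<infinity> else ereal (ln a))"

definition kl_term :: "real \<Rightarrow> real \<Rightarrow> ereal" where
  "kl_term a b = (if a = 0 then 0 else if b = 0 then \<infinity> else ereal (a * ln (a / b)))"

definition kl_div ::
  "'s set \<Rightarrow> ('s \<Rightarrow> real) \<Rightarrow> ('s, real) matrix \<Rightarrow> ('s, real) matrix \<Rightarrow> ereal" where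
  "kl_div X \<pi> M L = (\<Sum>x\<in>X. ereal (\<pi> x) * (\<Sum>y\<in>X. kl_term (M x y) (L x y)))"

definition log_mixtures :: "'s set \<Rightarrow> ('s, real) matrix set \<Rightarrow> ('s, ereal) matrix set" where
  "log_mixtures X F =
     {A. \<exists>l::nat. \<exists>c\<in>prob_weights {1..l}. \<exists>Q. (\<forall>i\<in>{1..l}. Q i \<in> F) \<and>
           (\<forall>x\<in>X. \<forall>y\<in>X. A x y = (\<Sum>i=1..l. ereal (c i) * elog (Q i x y)))}"

definition gen_kl_div ::
  "'s set \<Rightarrow> ('s \<Rightarrow> real) \<Rightarrow> ('s, real) matrix \<Rightarrow> ('s, ereal) matrix \<Rightarrow> ereal" where
  "gen_kl_div X \<pi> M A =
     (\<Sum>x\<in>X. \<Sum>y\<in>X. ereal (\<pi> x * M x y) * elog (M x y)) -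
     (\<Sum>x\<in>X. \<Sum>y\<in>X. ereal (\<pi> x * M x y) * A x y)"

definition opt_log ::
  "'a state set \<Rightarrow> ('a state \<Rightarrow> real) \<Rightarrow> nat \<Rightarrow> (nat \<Rightarrow> nat set) \<Rightarrow>
   ('n \<Rightarrow> ('a state, real) matrix) \<Rightarrow> real ^ 'n \<Rightarrow> ('a state, ereal) matrix" where
  "opt_log X \<pi> m Ss P w = (\<lambda>x y. elog (factor_product X \<pi> m Ss (mixture P w) x y))"

text \<open>Attained minimum and maximum values.\<close>

definition is_min_value :: "('b \<Rightarrow> 'c::linorder) \<Rightarrow> 'b set \<Rightarrow> 'c \<Rightarrow> bool" where
  "is_min_value f D v \<longleftrightarrow> (\<exists>a. is_arg_min f (\<lambda>x. x \<in> D) a \<and> f a = v)"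

definition is_max_value :: "('b \<Rightarrow> 'c::linorder) \<Rightarrow> 'b set \<Rightarrow> 'c \<Rightarrow> bool" where
  "is_max_value f D v \<longleftrightarrow> (\<exists>a. is_arg_max f (\<lambda>x. x \<in> D) a \<and> f a = v)"

text \<open>The primal problem minimizes \<open>snd\<close> over this set.\<close>
definition primal_feasible ::
  "'s set \<Rightarrow> ('s \<Rightarrow> real) \<Rightarrow> ('n \<Rightarrow> ('s, real) matrix) \<Rightarrow> ('s, ereal) matrix set \<Rightarrow>
   (('s, ereal) matrix \<times> real) set" where
  "primal_feasible X \<pi> P \<A> =
     {(A, r). A \<in> \<A> \<and> 0 \<le> r \<and> (\<forall>i. gen_kl_div X \<pi> (P i) A \<le> ereal r)}"

definition lagrangian ::
  "'s set \<Rightarrow> ('s \<Rightarrow> real) \<Rightarrow> ('n::finite \<Rightarrow> ('s, real) matrix) \<Rightarrow>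
   real \<Rightarrow> ('s, ereal) matrix \<Rightarrow> real ^ 'n \<Rightarrow> ereal" where
  "lagrangian X \<pi> P r A w =
     ereal r + (\<Sum>i\<in>UNIV. ereal (w $ i) * (gen_kl_div X \<pi> (P i) A - ereal r))"

text \<open>
  The dual problem maximizes this function over all \<open>w\<close> with nonnegative components. It is an
  infimum because its value is \<open>-\<infinity>\<close> when the components of \<open>w\<close> sum to more than \<open>1\<close>.
\<close>
definition dual_fun ::
  "'s set \<Rightarrow> ('s \<Rightarrow> real) \<Rightarrow> ('n::finite \<Rightarrow> ('s, real) matrix) \<Rightarrow> ('s, ereal) matrix set \<Rightarrow>
   real ^ 'n \<Rightarrow> ereal" where
  "dual_fun X \<pi> P \<A> w = (INF (r, A)\<in>{0..} \<times> \<A>. lagrangian X \<pi> P r A w)"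

definition nonneg_vectors :: "(real ^ 'n) set" where
  "nonneg_vectors = {w. \<forall>i. 0 \<le> w $ i}"

definition weighted_gen_kl ::
  "'a state set \<Rightarrow> ('a state \<Rightarrow> real) \<Rightarrow> nat \<Rightarrow> (nat \<Rightarrow> nat set) \<Rightarrow>
   ('n::finite \<Rightarrow> ('a state, real) matrix) \<Rightarrow> real ^ 'n \<Rightarrow> ereal" where
  "weighted_gen_kl X \<pi> m Ss P w =
     (\<Sum>i\<in>UNIV. ereal (w $ i) * gen_kl_div X \<pi> (P i) (opt_log X \<pi> m Ss P w))"

definition weighted_kl ::
  "'a state set \<Rightarrow> ('a state \<Rightarrow> real) \<Rightarrow> nat \<Rightarrow> (nat \<Rightarrow> nat set) \<Rightarrow>
   ('n::finite \<Rightarrow> ('a state, real) matrix) \<Rightarrow> real ^ 'n \<Rightarrow> ereal" where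
  "weighted_kl X \<pi> m Ss P w =
     (\<Sum>i\<in>UNIV. ereal (w $ i) * kl_div X \<pi> (P i) (factor_product X \<pi> m Ss (mixture P w)))"

end

theory Submission
  imports Defs "HOL-Real_Asymp.Real_Asymp"
begin

text \<open>
  The argument is the redundancy-capacity theorem of information theory, for the class of product
  models. Write \<open>D\<^sub>i(A)\<close> for the generalized divergence of \<open>P\<^sub>i\<close> from \<open>A\<close> and \<open>Q\<^sub>w\<close> for the product of
  the block marginals of the mixture \<open>M\<^sub>w = \<Sum>\<^sub>i w\<^sub>i P\<^sub>i\<close>.

  The Pythagorean step: for fixed \<open>w\<close>, the sum \<open>\<Sum>\<^sub>i w\<^sub>i D\<^sub>i(A)\<close> depends on \<open>A\<close> only through the cross
  entropy of \<open>M\<^sub>w\<close> and \<open>A\<close>. That is affine in \<open>A\<close>, so a mixture of logarithms does no better than the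
  logarithm of a single factorizable matrix, and for such a matrix the cross entropy splits into one
  term per block, each of which is optimized by the block marginal of \<open>M\<^sub>w\<close> by Gibbs' inequality
  (\<open>cross_entropy_factorizable_le\<close>, \<open>cross_entropy_log_mixture_le\<close>). Since \<open>Q\<^sub>w\<close> is itself
  factorizable (\<open>factor_product_factorizable\<close>), the function \<open>f(w) = \<Sum>\<^sub>i w\<^sub>i D\<^sub>i(log Q\<^sub>w)\<close> is the minimum
  over \<open>A\<close> of functions linear in \<open>w\<close>. Hence it is concave; it is also continuous on the compact
  simplex and so has a maximizer \<open>w\<^sup>*\<close>.

  The saddle point (\<open>saddle_point\<close>): move from \<open>w\<^sup>*\<close> a fraction \<open>t\<close> of the way to the vertex \<open>e\<^sub>i\<close>,
  to \<open>z = (1 - t) w\<^sup>* + t e\<^sub>i\<close>. Then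
  \<open>f(w\<^sup>*) \<ge> f(z) = (1 - t) (\<Sum>\<^sub>k w\<^sup>*\<^sub>k D\<^sub>k(log Q\<^sub>z)) + t D\<^sub>i(log Q\<^sub>z) \<ge> (1 - t) f(w\<^sup>*) + t D\<^sub>i(log Q\<^sub>z)\<close>, so
  \<open>D\<^sub>i(log Q\<^sub>z) \<le> f(w\<^sup>*)\<close>. Letting \<open>t\<close> tend to \<open>0\<close>, lower semicontinuity of the divergence gives
  \<open>D\<^sub>i(log Q) \<le> f(w\<^sup>*)\<close> for \<open>Q = Q\<^sub>w\<close> at \<open>w = w\<^sup>*\<close> and every \<open>i\<close>.

  All optimal values equal \<open>v = f(w\<^sup>*)\<close>: any \<open>A\<close> has \<open>max\<^sub>i D\<^sub>i(A) \<ge> \<Sum>\<^sub>i w\<^sup>*\<^sub>i D\<^sub>i(A) \<ge> v\<close>, and equality holds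
  at the logarithm of the factorizable matrix \<open>Q\<close>, which settles the minima over both classes. The Lagrangian at
  \<open>(v, log Q)\<close> is at most \<open>v\<close> for every nonnegative multiplier, and the dual function at \<open>w\<^sup>*\<close> is
  at least \<open>v\<close>. Complementary slackness is the case of equality in the averaging inequality.
\<close>

section \<open>Transition matrices and marginalization onto blocks\<close>

lemma transition_matricesD:
  assumes "M \<in> transition_matrices Y" "x \<in> Y"
  shows "y \<in> Y \<Longrightarrow> 0 \<le> M x y" and "(\<Sum>y\<in>Y. M x y) = 1"
  using assms by (auto simp: transition_matrices_def)

lemma transition_matrix_le_1:
  assumes "M \<in> transition_matrices Y" "finite Y" "x \<in> Y" "y \<in> Y"
  shows "M x y \<le> 1"
proof -
  have "M x y \<le> (\<Sum>y\<in>Y. M x y)"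
    using assms by (intro member_le_sum) (auto simp: transition_matrices_def)
  then show ?thesis using assms by (simp add: transition_matricesD)
qed

text \<open>
  The inequality \<open>ln t \<le> t - 1\<close> at \<open>t = b / a\<close>, summed with weights \<open>\<mu> a\<close>; the bounds add up to
  \<open>0\<close> because both matrices have rows of the same sum. Where \<open>\<mu> a = 0\<close> the logarithms have factor \<open>0\<close>,
  so \<open>ln 0\<close> never matters.
\<close>
lemma gibbs_transition:
  assumes fin: "finite Y" and a: "a \<in> transition_matrices Y" and b: "b \<in> transition_matrices Y"
    and \<mu>: "\<And>x. x \<in> Y \<Longrightarrow> 0 \<le> \<mu> x"
    and pos: "\<And>x y. x \<in> Y \<Longrightarrow> y \<in> Y \<Longrightarrow> 0 < \<mu> x * a x y \<Longrightarrow> 0 < b x y"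
  shows "(\<Sum>x\<in>Y. \<Sum>y\<in>Y. \<mu> x * a x y * ln (b x y)) \<le> (\<Sum>x\<in>Y. \<Sum>y\<in>Y. \<mu> x * a x y * ln (a x y))"
proof -
  have "\<mu> x * a x y * ln (b x y) - \<mu> x * a x y * ln (a x y) \<le> \<mu> x * b x y - \<mu> x * a x y"
    if xy: "x \<in> Y" "y \<in> Y" for x y
  proof (cases "\<mu> x * a x y = 0")
    case True
    then show ?thesis
      unfolding True using \<mu>[of x] transition_matricesD(1)[OF b xy] xy by simp
  next
    case False
    then have p: "0 < \<mu> x" "0 < a x y"
      using \<mu>[of x] transition_matricesD(1)[OF a xy] xy by auto
    then have q: "0 < b x y" using pos xy by simp
    have "ln (b x y) - ln (a x y) \<le> b x y / a x y - 1"
      using ln_le_minus_one[of "b x y / a x y"] p q by (simp add: ln_div)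
    then have "(\<mu> x * a x y) * (ln (b x y) - ln (a x y)) \<le> (\<mu> x * a x y) * (b x y / a x y - 1)"
      using p by (intro mult_left_mono) auto
    also have "\<dots> = \<mu> x * b x y - \<mu> x * a x y" using p by (simp add: field_simps)
    finally show ?thesis by (simp add: algebra_simps)
  qed
  then have "(\<Sum>x\<in>Y. \<Sum>y\<in>Y. \<mu> x * a x y * ln (b x y) - \<mu> x * a x y * ln (a x y))
      \<le> (\<Sum>x\<in>Y. \<Sum>y\<in>Y. \<mu> x * b x y - \<mu> x * a x y)"
    by (intro sum_mono)
  also have "\<dots> = 0"
    by (simp add: sum_subtractf transition_matricesD(2)[OF a] transition_matricesD(2)[OF b]
        flip: sum_distrib_left)
  finally show ?thesis by (simp add: sum_subtractf)
qed

lemma sum_fibres: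
  fixes h :: "'b \<Rightarrow> 'c::comm_monoid_add"
  assumes "finite X"
  shows "(\<Sum>u\<in>p ` X. \<Sum>x\<in>{x\<in>X. p x = u}. h x) = (\<Sum>x\<in>X. h x)"
  using assms by (intro sum.group) auto

locale weighted_states =
  fixes X :: "'a state set" and \<pi> :: "'a state \<Rightarrow> real"
  assumes finite_X: "finite X"
    and pi_pmf: "\<pi> \<in> full_support_pmfs X"
begin

definition block_states :: "nat set \<Rightarrow> 'a state set" where
  "block_states S = (\<lambda>x. restrict x S) ` X"

definition marginal :: "nat set \<Rightarrow> 'a state \<Rightarrow> real" where
  "marginal S u = (\<Sum>x\<in>{x\<in>X. restrict x S = u}. \<pi> x)"

lemma pi_pos: "x \<in> X \<Longrightarrow> 0 < \<pi> x"
  and sum_pi: "(\<Sum>x\<in>X. \<pi> x) = 1"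
  using pi_pmf by (auto simp: full_support_pmfs_def)

lemma finite_block_states: "finite (block_states S)"
  using finite_X by (simp add: block_states_def)

lemma restrict_in_block_states: "x \<in> X \<Longrightarrow> restrict x S \<in> block_states S"
  by (simp add: block_states_def)

lemma marginal_pos: "u \<in> block_states S \<Longrightarrow> 0 < marginal S u"
  unfolding marginal_def block_states_def by (rule sum_pos) (auto simp: finite_X pi_pos)

text \<open>
  Multiplying by the marginal clears the denominator, so identities for \<open>keep_in\<close> can be proved as
  identities between sums over fibres.
\<close>
lemma marginal_times_keep_in:
  assumes "u \<in> block_states S"
  shows "marginal S u * keep_in X \<pi> S M u v =
    (\<Sum>x\<in>{x\<in>X. restrict x S = u}. \<Sum>y\<in>{y\<in>X. restrict y S = v}. \<pi> x * M x y)"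
  using marginal_pos[OF assms] by (simp add: keep_in_def marginal_def)

text \<open>
  Under the joint law \<open>\<pi>(x) M(x, y)\<close> the pair of projections has joint law
  \<open>\<pi>\<^sup>S(u) M\<^sup>S(u, v)\<close>: an expectation of a function of the projections is an expectation over blocks.
\<close>
lemma sum_keep_in_marginal:
  "(\<Sum>x\<in>X. \<Sum>y\<in>X. \<pi> x * M x y * g (restrict x S) (restrict y S)) =
   (\<Sum>u\<in>block_states S. \<Sum>v\<in>block_states S. marginal S u * keep_in X \<pi> S M u v * g u v)"
proof -
  let ?h = "\<lambda>x y. \<pi> x * M x y * g (restrict x S) (restrict y S)"
  have "(\<Sum>v\<in>block_states S. marginal S u * keep_in X \<pi> S M u v * g u v) =
        (\<Sum>x\<in>{x\<in>X. restrict x S = u}. \<Sum>y\<in>X. ?h x y)" if u: "u \<in> block_states S" for u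
  proof -
    have "(\<Sum>v\<in>block_states S. marginal S u * keep_in X \<pi> S M u v * g u v) =
          (\<Sum>v\<in>block_states S. \<Sum>x\<in>{x\<in>X. restrict x S = u}. \<Sum>y\<in>{y\<in>X. restrict y S = v}. ?h x y)"
      by (intro sum.cong refl) (simp add: marginal_times_keep_in[OF u] sum_distrib_right)
    also have "\<dots> = (\<Sum>x\<in>{x\<in>X. restrict x S = u}. \<Sum>v\<in>block_states S. \<Sum>y\<in>{y\<in>X. restrict y S = v}. ?h x y)"
      by (rule sum.swap)
    also have "\<dots> = (\<Sum>x\<in>{x\<in>X. restrict x S = u}. \<Sum>y\<in>X. ?h x y)"
      unfolding block_states_def by (intro sum.cong refl sum_fibres finite_X)
    finally show ?thesis .
  qed
  then have "(\<Sum>u\<in>block_states S. \<Sum>v\<in>block_states S. marginal S u * keep_in X \<pi> S M u v * g u v) =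
      (\<Sum>u\<in>block_states S. \<Sum>x\<in>{x\<in>X. restrict x S = u}. \<Sum>y\<in>X. ?h x y)"
    by (rule sum.cong[OF refl])
  also have "\<dots> = (\<Sum>x\<in>X. \<Sum>y\<in>X. ?h x y)"
    unfolding block_states_def by (rule sum_fibres[OF finite_X])
  finally show ?thesis by simp
qed

lemma keep_in_transition:
  assumes M: "M \<in> transition_matrices X"
  shows "keep_in X \<pi> S M \<in> transition_matrices (block_states S)"
proof -
  have "(\<Sum>v\<in>block_states S. keep_in X \<pi> S M u v) = 1" if u: "u \<in> block_states S" for u
  proof -
    have "marginal S u * (\<Sum>v\<in>block_states S. keep_in X \<pi> S M u v) =
          (\<Sum>v\<in>block_states S. \<Sum>x\<in>{x\<in>X. restrict x S = u}. \<Sum>y\<in>{y\<in>X. restrict y S = v}. \<pi> x * M x y)"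
      by (simp add: sum_distrib_left marginal_times_keep_in[OF u])
    also have "\<dots> = (\<Sum>x\<in>{x\<in>X. restrict x S = u}. \<Sum>v\<in>block_states S. \<Sum>y\<in>{y\<in>X. restrict y S = v}. \<pi> x * M x y)"
      by (rule sum.swap)
    also have "\<dots> = (\<Sum>x\<in>{x\<in>X. restrict x S = u}. \<Sum>y\<in>X. \<pi> x * M x y)"
      unfolding block_states_def by (intro sum.cong refl sum_fibres finite_X)
    also have "\<dots> = marginal S u"
      unfolding marginal_def
      by (intro sum.cong refl) (auto simp: transition_matricesD[OF M] simp flip: sum_distrib_left)
    finally show ?thesis using marginal_pos[OF u] by simp
  qed
  moreover have "0 \<le> keep_in X \<pi> S M u v" for u v
    unfolding keep_in_def
    by (intro divide_nonneg_nonneg sum_nonneg mult_nonneg_nonneg)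
       (auto simp: pi_pos less_imp_le transition_matricesD[OF M])
  ultimately show ?thesis by (simp add: transition_matrices_def)
qed

lemma keep_in_pos:
  assumes M: "M \<in> transition_matrices X" and "x \<in> X" "y \<in> X" "0 < M x y"
  shows "0 < keep_in X \<pi> S M (restrict x S) (restrict y S)"
proof -
  have nn: "0 \<le> \<pi> x * M x y" if "x \<in> X" "y \<in> X" for x y
    using that by (simp add: pi_pos less_imp_le transition_matricesD[OF M])
  have "0 < (\<Sum>x\<in>{x'\<in>X. restrict x' S = restrict x S}. \<Sum>y\<in>{y'\<in>X. restrict y' S = restrict y S}. \<pi> x * M x y)"
  proof (rule sum_pos2[of _ x])
    show "0 < (\<Sum>y\<in>{y'\<in>X. restrict y' S = restrict y S}. \<pi> x * M x y)"
      by (rule sum_pos2[of _ y]) (use assms nn finite_X pi_pos in auto)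
  qed (use assms nn finite_X in \<open>auto intro!: sum_nonneg\<close>)
  then have "0 < marginal S (restrict x S) * keep_in X \<pi> S M (restrict x S) (restrict y S)"
    using restrict_in_block_states[OF \<open>x \<in> X\<close>] by (simp add: marginal_times_keep_in)
  then show ?thesis
    using marginal_pos[OF restrict_in_block_states[OF \<open>x \<in> X\<close>], of S] by (simp add: zero_less_mult_iff)
qed

end

locale product_states = weighted_states X \<pi>
  for X :: "'a state set" and \<pi> :: "'a state \<Rightarrow> real" +
  fixes d m :: nat and Xs :: "nat \<Rightarrow> 'a set" and Ss :: "nat \<Rightarrow> nat set"
  assumes X_eq: "X = Pi\<^sub>E {1..d} Xs"
    and partition: "partition_on {1..d} (Ss ` {1..m})"
    and Ss_inj: "inj_on Ss {1..m}"
begin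

lemma Ss_subset: "j \<in> {1..m} \<Longrightarrow> Ss j \<subseteq> {1..d}"
  using partition unfolding partition_on_def by blast

lemma block_exists:
  assumes "i \<in> {1..d}"
  obtains j where "j \<in> {1..m}" "i \<in> Ss j"
  using partition assms unfolding partition_on_def by blast

lemma block_unique:
  assumes "j \<in> {1..m}" "k \<in> {1..m}" "i \<in> Ss j" "i \<in> Ss k"
  shows "j = k"
proof (rule ccontr)
  assume "j \<noteq> k"
  then have "Ss j \<noteq> Ss k" using Ss_inj assms by (auto dest: inj_onD)
  then have "Ss j \<inter> Ss k = {}"
    using partition assms unfolding partition_on_def disjoint_def by blast
  then show False using assms by blast
qed

definition split_blocks :: "'a state \<Rightarrow> nat \<Rightarrow> 'a state" where
  "split_blocks y = (\<lambda>j\<in>{1..m}. restrict y (Ss j))"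

text \<open>
  A state is the same thing as a family of block states, one for each block, since every coordinate
  lies in exactly one block. This turns sums over states into products of sums over blocks.
\<close>
lemma split_blocks_bij:
  "bij_betw split_blocks X (Pi\<^sub>E {1..m} (\<lambda>j. block_states (Ss j)))"
proof (intro bij_betwI')
  fix x y assume xy: "x \<in> X" "y \<in> X"
  have "x = y" if e: "split_blocks x = split_blocks y"
  proof (rule PiE_ext)
    show "x \<in> Pi\<^sub>E {1..d} Xs" "y \<in> Pi\<^sub>E {1..d} Xs" using xy X_eq by auto
    fix i assume "i \<in> {1..d}"
    then obtain j where j: "j \<in> {1..m}" "i \<in> Ss j" by (rule block_exists)
    with fun_cong[OF e, of j] have "restrict x (Ss j) i = restrict y (Ss j) i"
      by (simp add: split_blocks_def)
    then show "x i = y i" using j by simp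
  qed
  then show "(split_blocks x = split_blocks y) = (x = y)" by auto
next
  fix x assume "x \<in> X"
  then show "split_blocks x \<in> Pi\<^sub>E {1..m} (\<lambda>j. block_states (Ss j))"
    by (auto simp: split_blocks_def restrict_in_block_states)
next
  fix z assume z: "z \<in> Pi\<^sub>E {1..m} (\<lambda>j. block_states (Ss j))"
  define b where "b i = (THE j. j \<in> {1..m} \<and> i \<in> Ss j)" for i
  have b: "b i = j" if "j \<in> {1..m}" "i \<in> Ss j" for i j
    unfolding b_def using that block_unique by (intro the_equality) auto
  define x where "x = (\<lambda>i\<in>{1..d}. z (b i) i)"
  have rx: "restrict x (Ss j) = z j" if j: "j \<in> {1..m}" for j
  proof -
    have "z j \<in> block_states (Ss j)" using z j by auto
    then obtain y where y: "z j = restrict y (Ss j)" by (auto simp: block_states_def)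
    show ?thesis
      using Ss_subset[OF j] by (auto simp: fun_eq_iff x_def b[OF j] y restrict_def)
  qed
  have "x \<in> Pi\<^sub>E {1..d} Xs"
  proof (rule PiE_I)
    fix i assume i: "i \<in> {1..d}"
    then obtain j where j: "j \<in> {1..m}" "i \<in> Ss j" by (rule block_exists)
    have "z j \<in> block_states (Ss j)" using z j by auto
    then obtain y where y: "y \<in> X" "z j = restrict y (Ss j)" by (auto simp: block_states_def)
    show "x i \<in> Xs i" using i j y b[OF j] by (auto simp: x_def X_eq)
  qed (auto simp: x_def)
  moreover have "z = split_blocks x"
  proof
    fix j
    show "z j = split_blocks x j"
      using PiE_arb[OF z, of j] by (cases "j \<in> {1..m}") (simp_all add: split_blocks_def rx)
  qed
  ultimately show "\<exists>x\<in>X. z = split_blocks x" using X_eq by auto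
qed

lemma sum_prod_blocks:
  fixes f :: "nat \<Rightarrow> 'a state \<Rightarrow> real"
  shows "(\<Sum>y\<in>X. \<Prod>j=1..m. f j (restrict y (Ss j))) = (\<Prod>j=1..m. \<Sum>v\<in>block_states (Ss j). f j v)"
proof -
  have "(\<Prod>j=1..m. \<Sum>v\<in>block_states (Ss j). f j v) =
        (\<Sum>z\<in>Pi\<^sub>E {1..m} (\<lambda>j. block_states (Ss j)). \<Prod>j=1..m. f j (z j))"
    by (rule prod_sum_PiE) (auto simp: finite_block_states)
  also have "\<dots> = (\<Sum>y\<in>X. \<Prod>j=1..m. f j (split_blocks y j))"
    by (rule sum.reindex_bij_betw[OF split_blocks_bij, symmetric])
  finally show ?thesis by (simp add: split_blocks_def)
qed

lemma tensor_transition: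
  assumes "\<And>j. j \<in> {1..m} \<Longrightarrow> M j \<in> transition_matrices (block_states (Ss j))"
  shows "tensor m Ss M \<in> transition_matrices X"
proof -
  have "(\<Sum>y\<in>X. tensor m Ss M x y) = 1" if "x \<in> X" for x
    unfolding tensor_def sum_prod_blocks[of "\<lambda>j. M j (restrict x (Ss j))"]
    by (intro prod.neutral ballI transition_matricesD(2)[OF assms] restrict_in_block_states that)
  moreover have "0 \<le> tensor m Ss M x y" if "x \<in> X" "y \<in> X" for x y
    unfolding tensor_def
    by (intro prod_nonneg transition_matricesD(1)[OF assms] restrict_in_block_states that)
  ultimately show ?thesis by (simp add: transition_matrices_def)
qed

text \<open>
  The block marginals of a product of transition matrices are its factors: summing over the other
  coordinates of the target state contributes a row sum \<open>1\<close> for each other block, so that the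
  \<open>\<pi>\<close>-average over the source fibre is an average of a constant.
\<close>
lemma keep_in_tensor:
  assumes M: "\<And>j. j \<in> {1..m} \<Longrightarrow> M j \<in> transition_matrices (block_states (Ss j))"
    and k: "k \<in> {1..m}" and u: "u \<in> block_states (Ss k)" and v: "v \<in> block_states (Ss k)"
  shows "keep_in X \<pi> (Ss k) (tensor m Ss M) u v = M k u v"
proof -
  have row: "(\<Sum>y\<in>{y\<in>X. restrict y (Ss k) = v}. tensor m Ss M x y) = M k (restrict x (Ss k)) v"
    if x: "x \<in> X" for x
  proof -
    \<comment> \<open>inserting the indicator of \<open>v\<close> into factor \<open>k\<close> keeps the fibre sum a product over blocks\<close>
    define f where "f j w = (if j = k \<longrightarrow> w = v then M j (restrict x (Ss j)) w else 0)" for j w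
    have "(\<Sum>y\<in>{y\<in>X. restrict y (Ss k) = v}. tensor m Ss M x y) =
          (\<Sum>y\<in>X. if restrict y (Ss k) = v then tensor m Ss M x y else 0)"
      by (rule sum.inter_filter[OF finite_X])
    also have "\<dots> = (\<Sum>y\<in>X. \<Prod>j=1..m. f j (restrict y (Ss j)))"
    proof (intro sum.cong refl)
      fix y
      show "(if restrict y (Ss k) = v then tensor m Ss M x y else 0) = (\<Prod>j=1..m. f j (restrict y (Ss j)))"
      proof (cases "restrict y (Ss k) = v")
        case True
        then show ?thesis by (auto simp: tensor_def f_def intro!: prod.cong)
      next
        case False
        then have "f k (restrict y (Ss k)) = 0" by (simp add: f_def)
        then have "(\<Prod>j=1..m. f j (restrict y (Ss j))) = 0" using k by (intro prod_zero) auto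
        then show ?thesis using False by simp
      qed
    qed
    also have "\<dots> = (\<Prod>j=1..m. \<Sum>w\<in>block_states (Ss j). f j w)" by (rule sum_prod_blocks)
    also have "\<dots> = (\<Prod>j=1..m. if j = k then M k (restrict x (Ss k)) v else 1)"
    proof (intro prod.cong refl)
      fix j assume j: "j \<in> {1..m}"
      show "(\<Sum>w\<in>block_states (Ss j). f j w) = (if j = k then M k (restrict x (Ss k)) v else 1)"
        using transition_matricesD(2)[OF M[OF j] restrict_in_block_states[OF x]] v
        by (auto simp: f_def finite_block_states)
    qed
    also have "\<dots> = M k (restrict x (Ss k)) v" using k by simp
    finally show ?thesis .
  qed
  have "marginal (Ss k) u * keep_in X \<pi> (Ss k) (tensor m Ss M) u v =
        (\<Sum>x\<in>{x\<in>X. restrict x (Ss k) = u}. \<pi> x * M k u v)"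
    unfolding marginal_times_keep_in[OF u]
    by (intro sum.cong refl) (auto simp: row simp flip: sum_distrib_left)
  also have "\<dots> = marginal (Ss k) u * M k u v"
    by (simp add: marginal_def sum_distrib_right)
  finally show ?thesis using marginal_pos[OF u] by simp
qed

abbreviation fp :: "('a state, real) matrix \<Rightarrow> ('a state, real) matrix" where
  "fp \<equiv> factor_product X \<pi> m Ss"

lemma factor_product_transition:
  "M \<in> transition_matrices X \<Longrightarrow> fp M \<in> transition_matrices X"
  unfolding factor_product_def by (intro tensor_transition keep_in_transition)

text \<open>
  Taking the product of block marginals is idempotent, by \<open>keep_in_tensor\<close>.
\<close>
lemma factor_product_factorizable:
  assumes "M \<in> transition_matrices X"
  shows "fp M \<in> factorizable X \<pi> m Ss"
proof -
  have "fp M x y = fp (fp M) x y" if "x \<in> X" "y \<in> X" for x y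
    unfolding factor_product_def tensor_def[of m Ss "\<lambda>j. keep_in X \<pi> (Ss j) (tensor _ _ _)"]
    by (simp add: keep_in_tensor keep_in_transition assms restrict_in_block_states that)
       (simp add: tensor_def)
  then show ?thesis
    using factor_product_transition[OF assms] by (simp add: factorizable_def)
qed

lemma factor_product_pos:
  assumes "M \<in> transition_matrices X" and "x \<in> X" "y \<in> X" "0 < M x y"
  shows "0 < fp M x y"
  unfolding factor_product_def tensor_def by (intro prod_pos ballI keep_in_pos assms)

text \<open>
  The logarithm of a product is a sum over blocks, and each summand depends on its block only. The
  positivity hypothesis is what lets \<open>ln\<close> distribute over the product wherever the weight is nonzero.
\<close>
lemma cross_entropy_tensor:
  assumes M: "M \<in> transition_matrices X"
    and N: "\<And>j x y. j \<in> {1..m} \<Longrightarrow> x \<in> X \<Longrightarrow> y \<in> X \<Longrightarrow> 0 < M x y \<Longrightarrow>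
       0 < N j (restrict x (Ss j)) (restrict y (Ss j))"
  shows "(\<Sum>x\<in>X. \<Sum>y\<in>X. \<pi> x * M x y * ln (tensor m Ss N x y)) =
     (\<Sum>j=1..m. \<Sum>u\<in>block_states (Ss j). \<Sum>v\<in>block_states (Ss j).
        marginal (Ss j) u * keep_in X \<pi> (Ss j) M u v * ln (N j u v))"
proof -
  have "\<pi> x * M x y * ln (tensor m Ss N x y) =
     (\<Sum>j=1..m. \<pi> x * M x y * ln (N j (restrict x (Ss j)) (restrict y (Ss j))))"
    if xy: "x \<in> X" "y \<in> X" for x y
  proof (cases "M x y = 0")
    case False
    then have p: "0 < M x y" using transition_matricesD(1)[OF M xy] by simp
    have "N j (restrict x (Ss j)) (restrict y (Ss j)) \<noteq> 0" if "j \<in> {1..m}" for j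
      using N[OF that xy p] by simp
    then have "ln (tensor m Ss N x y) = (\<Sum>j=1..m. ln (N j (restrict x (Ss j)) (restrict y (Ss j))))"
      unfolding tensor_def by (intro ln_prod) auto
    then show ?thesis by (simp add: sum_distrib_left)
  qed simp
  then have "(\<Sum>x\<in>X. \<Sum>y\<in>X. \<pi> x * M x y * ln (tensor m Ss N x y)) =
     (\<Sum>x\<in>X. \<Sum>y\<in>X. \<Sum>j=1..m. \<pi> x * M x y * ln (N j (restrict x (Ss j)) (restrict y (Ss j))))"
    by (intro sum.cong refl)
  also have "\<dots> = (\<Sum>j=1..m. \<Sum>x\<in>X. \<Sum>y\<in>X. \<pi> x * M x y * ln (N j (restrict x (Ss j)) (restrict y (Ss j))))"
    by (simp only: sum.swap[of _ X "{1..m}"])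
  also have "\<dots> = (\<Sum>j=1..m. \<Sum>u\<in>block_states (Ss j). \<Sum>v\<in>block_states (Ss j).
        marginal (Ss j) u * keep_in X \<pi> (Ss j) M u v * ln (N j u v))"
    by (intro sum.cong refl sum_keep_in_marginal)
  finally show ?thesis .
qed

text \<open>
  Among factorizable matrices the product of the block marginals of \<open>M\<close> maximizes the
  expected logarithm under \<open>\<pi>(x) M(x, y)\<close>, because by \<open>cross_entropy_tensor\<close> both sides split into blocks and Gibbs'
  inequality applies to each block.
\<close>
lemma cross_entropy_factorizable_le:
  assumes M: "M \<in> transition_matrices X" and Q: "Q \<in> factorizable X \<pi> m Ss"
    and pos: "\<And>x y. x \<in> X \<Longrightarrow> y \<in> X \<Longrightarrow> 0 < M x y \<Longrightarrow> 0 < Q x y"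
  shows "(\<Sum>x\<in>X. \<Sum>y\<in>X. \<pi> x * M x y * ln (Q x y)) \<le> (\<Sum>x\<in>X. \<Sum>y\<in>X. \<pi> x * M x y * ln (fp M x y))"
proof -
  have QT: "Q \<in> transition_matrices X" and Qf: "\<And>x y. x \<in> X \<Longrightarrow> y \<in> X \<Longrightarrow> Q x y = fp Q x y"
    using Q by (auto simp: factorizable_def)
  let ?k = "\<lambda>M j. keep_in X \<pi> (Ss j) M"
  have Qp: "0 < ?k Q j (restrict x (Ss j)) (restrict y (Ss j))"
    if "j \<in> {1..m}" "x \<in> X" "y \<in> X" "0 < M x y" for j x y
    by (intro keep_in_pos QT that pos)
  have "(\<Sum>x\<in>X. \<Sum>y\<in>X. \<pi> x * M x y * ln (Q x y)) = (\<Sum>x\<in>X. \<Sum>y\<in>X. \<pi> x * M x y * ln (fp Q x y))"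
    by (intro sum.cong refl) (simp flip: Qf)
  also have "\<dots> = (\<Sum>j=1..m. \<Sum>u\<in>block_states (Ss j). \<Sum>v\<in>block_states (Ss j).
        marginal (Ss j) u * ?k M j u v * ln (?k Q j u v))"
    unfolding factor_product_def by (intro cross_entropy_tensor M Qp)
  also have "\<dots> \<le> (\<Sum>j=1..m. \<Sum>u\<in>block_states (Ss j). \<Sum>v\<in>block_states (Ss j).
        marginal (Ss j) u * ?k M j u v * ln (?k M j u v))"
  proof (rule sum_mono, rule gibbs_transition[OF finite_block_states keep_in_transition[OF M] keep_in_transition[OF QT]])
    fix j u v assume j: "j \<in> {1..m}" and uv: "u \<in> block_states (Ss j)" "v \<in> block_states (Ss j)"
      and p: "0 < marginal (Ss j) u * ?k M j u v"
    \<comment> \<open>if the entry of \<open>Q\<close> vanished, \<open>M\<close> would vanish on the whole fibre over \<open>(u, v)\<close>\<close>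
    show "0 < ?k Q j u v"
    proof (rule ccontr)
      assume "\<not> 0 < ?k Q j u v"
      have z: "\<pi> x * M x y = 0" if "x \<in> {x\<in>X. restrict x (Ss j) = u}" "y \<in> {y\<in>X. restrict y (Ss j) = v}" for x y
      proof (rule ccontr)
        assume "\<pi> x * M x y \<noteq> 0"
        then have "0 < M x y" using that transition_matricesD(1)[OF M, of x y] by auto
        then show False using Qp[OF j, of x y] that \<open>\<not> 0 < ?k Q j u v\<close> by auto
      qed
      have "marginal (Ss j) u * ?k M j u v = 0"
        unfolding marginal_times_keep_in[OF uv(1)] by (intro sum.neutral ballI z)
      then show False using p by linarith
    qed
  qed (auto simp: marginal_pos less_imp_le)
  also have "\<dots> = (\<Sum>x\<in>X. \<Sum>y\<in>X. \<pi> x * M x y * ln (fp M x y))"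
    unfolding factor_product_def by (intro cross_entropy_tensor[symmetric] M keep_in_pos)
  finally show ?thesis .
qed

end

section \<open>Generalized divergence and mixtures of logarithms\<close>

lemma sum_ereal_eq_MInfty:
  fixes f :: "'b \<Rightarrow> ereal"
  assumes "finite I" "i \<in> I" "f i = -\<infinity>" "\<And>j. j \<in> I \<Longrightarrow> f j \<noteq> \<infinity>"
  shows "sum f I = -\<infinity>"
proof -
  have "sum f (I - {i}) \<noteq> \<infinity>"
    using assms by (auto simp: sum_Pinfty)
  then show ?thesis
    using assms by (simp add: sum.remove[of I i])
qed

text \<open>
  Together with \<open>gen_kl_div_infinite\<close> this reduces the extended-real divergence to a dichotomy: it is
  infinite if \<open>A = -\<infinity>\<close> somewhere on the support of \<open>M\<close>, and a real sum otherwise.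
\<close>
lemma gen_kl_div_real:
  assumes "\<And>x y. x \<in> X \<Longrightarrow> y \<in> X \<Longrightarrow> M x y \<noteq> 0 \<Longrightarrow> A x y = ereal (a x y)"
  shows "gen_kl_div X \<pi> M A = ereal (\<Sum>x\<in>X. \<Sum>y\<in>X. \<pi> x * M x y * (ln (M x y) - a x y))"
proof -
  have 1: "ereal (\<pi> x * M x y) * elog (M x y) = ereal (\<pi> x * M x y * ln (M x y))" for x y
    by (simp add: elog_def)
  have 2: "ereal (\<pi> x * M x y) * A x y = ereal (\<pi> x * M x y * a x y)" if "x \<in> X" "y \<in> X" for x y
    using assms[OF that] by (cases "M x y = 0") (simp_all flip: zero_ereal_def)
  show ?thesis
    unfolding gen_kl_div_def
    by (simp add: 1 2 right_diff_distrib sum_subtractf cong: sum.cong)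
qed

lemma gen_kl_div_infinite:
  assumes "finite X" and M: "M \<in> transition_matrices X" and \<pi>: "\<And>x. x \<in> X \<Longrightarrow> 0 < \<pi> x"
    and A: "\<And>x y. x \<in> X \<Longrightarrow> y \<in> X \<Longrightarrow> A x y \<noteq> \<infinity>"
    and xy: "x \<in> X" "y \<in> X" "0 < M x y" "A x y = -\<infinity>"
  shows "gen_kl_div X \<pi> M A = \<infinity>"
proof -
  have fin: "ereal (\<pi> x * M x y) * A x y \<noteq> \<infinity>" if "x \<in> X" "y \<in> X" for x y
    using A[OF that] \<pi>[of x] transition_matricesD(1)[OF M that] that
    by (cases "A x y") auto
  have "(\<Sum>y\<in>X. ereal (\<pi> x * M x y) * A x y) = -\<infinity>"
  proof (rule sum_ereal_eq_MInfty)
    show "ereal (\<pi> x * M x y) * A x y = -\<infinity>" using xy \<pi>[OF xy(1)] by simp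
  qed (use assms(1) xy fin in auto)
  then have "(\<Sum>x\<in>X. \<Sum>y\<in>X. ereal (\<pi> x * M x y) * A x y) = -\<infinity>"
    by (rule sum_ereal_eq_MInfty[OF assms(1) xy(1)]) (use fin in \<open>auto simp: sum_Pinfty\<close>)
  moreover have "ereal (\<pi> x * M x y) * elog (M x y) = ereal (\<pi> x * M x y * ln (M x y))" for x y
    by (simp add: elog_def)
  ultimately show ?thesis by (simp add: gen_kl_div_def)
qed

lemma kl_div_eq_gen_kl_div:
  assumes fin: "finite X" and M: "M \<in> transition_matrices X" and \<pi>: "\<And>x. x \<in> X \<Longrightarrow> 0 < \<pi> x"
    and Q: "Q \<in> transition_matrices X"
  shows "kl_div X \<pi> M Q = gen_kl_div X \<pi> M (\<lambda>x y. elog (Q x y))"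
proof (cases "\<exists>x\<in>X. \<exists>y\<in>X. 0 < M x y \<and> Q x y = 0")
  case True
  then obtain x y where xy: "x \<in> X" "y \<in> X" "0 < M x y" "Q x y = 0" by auto
  have "gen_kl_div X \<pi> M (\<lambda>x y. elog (Q x y)) = \<infinity>"
    by (rule gen_kl_div_infinite[where x = x and y = y]) (use xy fin M \<pi> in \<open>auto simp: elog_def\<close>)
  moreover have "(\<Sum>y\<in>X. kl_term (M x y) (Q x y)) = \<infinity>"
    using xy fin by (auto simp: sum_Pinfty kl_term_def intro!: bexI[of _ y])
  then have "ereal (\<pi> x) * (\<Sum>y\<in>X. kl_term (M x y) (Q x y)) = \<infinity>"
    using \<pi>[OF xy(1)] by simp
  then have "kl_div X \<pi> M Q = \<infinity>"
    unfolding kl_div_def sum_Pinfty using xy fin by blast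
  ultimately show ?thesis by simp
next
  case False
  have 1: "0 < M x y \<and> 0 < Q x y" if "x \<in> X" "y \<in> X" "M x y \<noteq> 0" for x y
    using False that transition_matricesD(1)[OF M that(1,2)] transition_matricesD(1)[OF Q that(1,2)]
    by force
  have "kl_term (M x y) (Q x y) = ereal (M x y * (ln (M x y) - ln (Q x y)))"
    if "x \<in> X" "y \<in> X" for x y
    using 1[OF that] by (cases "M x y = 0") (auto simp: kl_term_def ln_div)
  then have "kl_div X \<pi> M Q = ereal (\<Sum>x\<in>X. \<Sum>y\<in>X. \<pi> x * M x y * (ln (M x y) - ln (Q x y)))"
    by (simp add: kl_div_def sum_distrib_left mult.assoc cong: sum.cong)
  also have "\<dots> = gen_kl_div X \<pi> M (\<lambda>x y. elog (Q x y))"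
    using 1 by (intro gen_kl_div_real[symmetric]) (fastforce simp: elog_def)
  finally show ?thesis .
qed

text \<open>
  A weighted sum of logarithms is \<open>-\<infinity>\<close> as soon as one of the numbers of positive weight is zero.
  Otherwise it is the real sum with \<open>ln 0 = 0\<close>, as zeros then occur with weight \<open>0\<close> only.
\<close>
lemma ereal_log_mean_cases:
  fixes c q :: "nat \<Rightarrow> real"
  assumes "finite I" and c: "\<And>i. i \<in> I \<Longrightarrow> 0 \<le> c i"
  shows "(\<Sum>i\<in>I. ereal (c i) * elog (q i)) \<noteq> \<infinity>" (is "?s \<noteq> _")
    and "(\<Sum>i\<in>I. ereal (c i) * elog (q i)) \<noteq> -\<infinity> \<Longrightarrow> i \<in> I \<Longrightarrow> 0 < c i \<Longrightarrow> q i \<noteq> 0"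
    and "(\<Sum>i\<in>I. ereal (c i) * elog (q i)) \<noteq> -\<infinity> \<Longrightarrow>
      (\<Sum>i\<in>I. ereal (c i) * elog (q i)) = ereal (\<Sum>i\<in>I. c i * ln (q i))"
proof -
  have t: "ereal (c i) * elog (q i) \<noteq> \<infinity>" if "i \<in> I" for i
    using c[OF that] by (auto simp: elog_def)
  then show "?s \<noteq> \<infinity>" using assms(1) by (auto simp: sum_Pinfty)
  have pos: "q i \<noteq> 0" if "?s \<noteq> -\<infinity>" "i \<in> I" "0 < c i" for i
  proof
    assume "q i = 0"
    then have "ereal (c i) * elog (q i) = -\<infinity>" using that by (simp add: elog_def)
    then have "?s = -\<infinity>" using t that assms(1) by (intro sum_ereal_eq_MInfty[of _ i]) auto
    then show False using that by simp
  qed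
  then show "?s \<noteq> -\<infinity> \<Longrightarrow> i \<in> I \<Longrightarrow> 0 < c i \<Longrightarrow> q i \<noteq> 0" for i .
  assume "?s \<noteq> -\<infinity>"
  then have "ereal (c i) * elog (q i) = ereal (c i * ln (q i))" if "i \<in> I" for i
    using pos[OF \<open>?s \<noteq> -\<infinity>\<close> that] c[OF that]
    by (cases "c i = 0") (simp_all add: elog_def zero_ereal_def[symmetric])
  then show "?s = ereal (\<Sum>i\<in>I. c i * ln (q i))" by (simp cong: sum.cong)
qed

lemma log_mixture_not_PInfty:
  assumes "A \<in> log_mixtures X F" "x \<in> X" "y \<in> X"
  shows "A x y \<noteq> \<infinity>"
proof -
  from assms obtain l c Q where c: "c \<in> prob_weights {1..l}"
    and A: "A x y = (\<Sum>k=1..l::nat. ereal (c k) * elog (Q k x y))"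
    unfolding log_mixtures_def by auto
  show ?thesis
    unfolding A using c by (intro ereal_log_mean_cases(1)) (auto simp: prob_weights_def)
qed

lemma elog_in_log_mixtures:
  assumes "Q \<in> F"
  shows "(\<lambda>x y. elog (Q x y)) \<in> log_mixtures X F"
  unfolding log_mixtures_def mem_Collect_eq
proof (intro exI bexI conjI ballI)
  show "(\<lambda>_. 1) \<in> prob_weights {1..1::nat}" by (simp add: prob_weights_def)
  show "elog (Q x y) = (\<Sum>i=1..1::nat. ereal 1 * elog (Q x y))" for x y by simp
qed (rule assms)

text \<open>
  The cross entropy is affine in its second argument, so a bound for the logarithms of the members of
  \<open>F\<close> extends to convex combinations of these logarithms. The support condition passes to every
  member of positive weight.
\<close>
lemma cross_entropy_log_mixture_le:
  assumes fin: "finite X" and M: "M \<in> transition_matrices X" and A: "A \<in> log_mixtures X F"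
    and supp: "\<And>x y. x \<in> X \<Longrightarrow> y \<in> X \<Longrightarrow> 0 < M x y \<Longrightarrow> A x y \<noteq> -\<infinity>"
    and F: "F \<subseteq> transition_matrices X"
    and bound: "\<And>Q. Q \<in> F \<Longrightarrow> (\<And>x y. x \<in> X \<Longrightarrow> y \<in> X \<Longrightarrow> 0 < M x y \<Longrightarrow> 0 < Q x y) \<Longrightarrow>
       (\<Sum>x\<in>X. \<Sum>y\<in>X. \<pi> x * M x y * ln (Q x y)) \<le> B"
  shows "(\<Sum>x\<in>X. \<Sum>y\<in>X. \<pi> x * M x y * real_of_ereal (A x y)) \<le> B"
proof -
  from A obtain l c Q where c: "c \<in> prob_weights {1..l}" and Q: "\<And>k. k \<in> {1..l} \<Longrightarrow> Q k \<in> F"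
    and Aeq: "\<And>x y. x \<in> X \<Longrightarrow> y \<in> X \<Longrightarrow> A x y = (\<Sum>k=1..l::nat. ereal (c k) * elog (Q k x y))"
    unfolding log_mixtures_def mem_Collect_eq by blast
  have c0: "0 \<le> c k" if "k \<in> {1..l}" for k
    using c that by (auto simp: prob_weights_def)
  have c1: "(\<Sum>k=1..l. c k) = 1"
    using c by (auto simp: prob_weights_def)
  have "\<pi> x * M x y * real_of_ereal (A x y) = (\<Sum>k=1..l. c k * (\<pi> x * M x y * ln (Q k x y)))"
    if xy: "x \<in> X" "y \<in> X" for x y
  proof (cases "M x y = 0")
    case False
    then have "0 < M x y" using transition_matricesD(1)[OF M xy] by simp
    then have "A x y = ereal (\<Sum>k=1..l. c k * ln (Q k x y))"
      using supp[OF xy] unfolding Aeq[OF xy]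
      by (intro ereal_log_mean_cases(3)) (auto simp: c0)
    then show ?thesis by (simp add: sum_distrib_left mult_ac)
  qed simp
  then have "(\<Sum>x\<in>X. \<Sum>y\<in>X. \<pi> x * M x y * real_of_ereal (A x y)) =
      (\<Sum>x\<in>X. \<Sum>y\<in>X. \<Sum>k=1..l. c k * (\<pi> x * M x y * ln (Q k x y)))"
    by (intro sum.cong refl)
  also have "\<dots> = (\<Sum>k=1..l. c k * (\<Sum>x\<in>X. \<Sum>y\<in>X. \<pi> x * M x y * ln (Q k x y)))"
    by (simp only: sum.swap[of _ X "{1..l}"] sum_distrib_left)
  also have "\<dots> \<le> (\<Sum>k=1..l. c k * B)"
  proof (intro sum_mono)
    fix k assume k: "k \<in> {1..l}"
    show "c k * (\<Sum>x\<in>X. \<Sum>y\<in>X. \<pi> x * M x y * ln (Q k x y)) \<le> c k * B"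
    proof (cases "c k = 0")
      case False
      then have "0 < c k" using c0[OF k] by simp
      have "0 < Q k x y" if xy: "x \<in> X" "y \<in> X" "0 < M x y" for x y
      proof -
        have "Q k x y \<noteq> 0"
          using ereal_log_mean_cases(2)[of "{1..l}" c "\<lambda>k. Q k x y" k] supp[OF xy] Aeq[OF xy(1,2)]
            c0 k \<open>0 < c k\<close> by auto
        moreover have "0 \<le> Q k x y"
          using transition_matricesD(1)[of "Q k" X x y] Q[OF k] F xy by auto
        ultimately show ?thesis by simp
      qed
      then show ?thesis by (intro mult_left_mono bound Q k c0)
    qed simp
  qed
  also have "\<dots> = B" unfolding sum_distrib_right[symmetric] c1 by simp
  finally show ?thesis .
qed

section \<open>The entropy function and the weight simplex\<close>

text \<open>
  The function under the entropy sum is continuous up to the boundary. At \<open>0\<close> this holds because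
  \<open>t ln t\<close> tends to \<open>0\<close>, which is also its value there by \<open>ln 0 = 0\<close>.
\<close>
lemma continuous_on_mult_ln: "continuous_on {0..} (\<lambda>t::real. t * ln t)"
proof (clarsimp simp: continuous_on_eq_continuous_within)
  fix t :: real assume "0 \<le> t"
  show "continuous (at t within {0..}) (\<lambda>t. t * ln t)"
  proof (cases "t = 0")
    case True
    have "((\<lambda>t::real. t * ln t) \<longlongrightarrow> 0) (at_right 0)" by real_asymp
    then have "((\<lambda>t::real. t * ln t) \<longlongrightarrow> 0) (at 0 within {0..})"
      by (simp add: at_within_Ici_at_right)
    then show ?thesis by (simp add: continuous_within True)
  next
    case False
    then show ?thesis using \<open>0 \<le> t\<close> by (intro continuous_intros) auto
  qed
qed

lemma prob_simplexD:
  assumes "w \<in> prob_simplex"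
  shows "0 \<le> w $ i" and "(\<Sum>i\<in>UNIV. w $ i) = 1"
  using assms by (auto simp: prob_simplex_def prob_weights_def)

lemma compact_prob_simplex: "compact (prob_simplex :: (real ^ 'n::finite) set)"
proof (rule compact_eq_bounded_closed[THEN iffD2], intro conjI)
  have "norm w \<le> 1" if "w \<in> prob_simplex" for w :: "real ^ 'n"
    using norm_le_l1_cart[of w] prob_simplexD[OF that] by simp
  then show "bounded (prob_simplex :: (real ^ 'n) set)" by (auto simp: bounded_iff)
  have "prob_simplex = {w :: real ^ 'n. \<forall>i. 0 \<le> w $ i} \<inter> {w. (\<Sum>i\<in>UNIV. w $ i) = 1}"
    by (auto simp: prob_simplex_def prob_weights_def)
  moreover have "closed \<dots>"
    by (intro closed_Int closed_Collect_all closed_Collect_le closed_Collect_eq continuous_intros)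
  ultimately show "closed (prob_simplex :: (real ^ 'n) set)" by simp
qed

lemma convex_prob_simplex: "convex (prob_simplex :: (real ^ 'n::finite) set)"
  unfolding convex_def prob_simplex_def prob_weights_def
  by (auto simp: sum.distrib simp flip: sum_distrib_left)

lemma axis_in_prob_simplex: "axis i 1 \<in> (prob_simplex :: (real ^ 'n::finite) set)"
  by (auto simp: prob_simplex_def prob_weights_def axis_def)

lemma sum_axis_mult: "(\<Sum>k\<in>UNIV. axis i 1 $ k * h k) = (h i :: real)"
  by (simp add: axis_def if_distrib[of "\<lambda>c. c * _"] cong: if_cong)

lemma sum_segment_weights:
  "(\<Sum>i\<in>UNIV. ((1 - t) *\<^sub>R w + t *\<^sub>R u) $ i * h i) =
   (1 - t) * (\<Sum>i\<in>UNIV. w $ i * h i) + t * (\<Sum>i\<in>UNIV. u $ i * (h i :: real))"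
  by (simp add: distrib_right sum.distrib sum_distrib_left mult.assoc)

lemma segment_in_simplex:
  assumes "w \<in> prob_simplex" "u \<in> prob_simplex" "0 \<le> t" "t \<le> 1"
  shows "(1 - t) *\<^sub>R w + t *\<^sub>R u \<in> (prob_simplex :: (real ^ 'n) set)"
  using convexD[OF convex_prob_simplex, of w u "1 - t" t] assms by simp

text \<open>
  In the open segment the support of the weight vector is the union of the supports of the endpoints.
  Hence the fitted product model there has finite divergence for every family member that either
  endpoint charges.
\<close>
lemma segment_pos:
  assumes "w \<in> prob_simplex" "u \<in> prob_simplex" "0 < t" "t < 1" "0 < w $ i \<or> 0 < u $ i"
  shows "0 < ((1 - t) *\<^sub>R w + t *\<^sub>R u) $ i"
  using prob_simplexD(1)[OF assms(1), of i] prob_simplexD(1)[OF assms(2), of i] assms(3-)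
  by (auto intro: add_pos_nonneg add_nonneg_pos)

text \<open>
  The terms in \<open>r\<close> cancel when the multipliers sum to \<open>1\<close>; an infinite divergence of positive weight
  makes both sides infinite.
\<close>
lemma lagrangian_simplex:
  fixes D :: "'n::finite \<Rightarrow> ereal"
  assumes w: "w \<in> prob_simplex" and D: "\<And>i. D i \<noteq> -\<infinity>"
  shows "ereal r + (\<Sum>i\<in>UNIV. ereal (w $ i) * (D i - ereal r)) = (\<Sum>i\<in>UNIV. ereal (w $ i) * D i)"
proof (cases "\<exists>i. 0 < w $ i \<and> D i = \<infinity>")
  case True
  then obtain i where i: "0 < w $ i" "D i = \<infinity>" by auto
  then have "(\<Sum>i\<in>UNIV. ereal (w $ i) * (D i - ereal r)) = \<infinity>" "(\<Sum>i\<in>UNIV. ereal (w $ i) * D i) = \<infinity>"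
    by (auto simp: sum_Pinfty intro!: exI[of _ i])
  then show ?thesis by simp
next
  case False
  have "ereal (w $ i) * (D i - ereal r) = ereal (w $ i * real_of_ereal (D i) - w $ i * r)
     \<and> ereal (w $ i) * D i = ereal (w $ i * real_of_ereal (D i))" for i
    using False D[of i] prob_simplexD(1)[OF w, of i]
    by (cases "D i"; cases "w $ i = 0") (auto simp: algebra_simps simp flip: zero_ereal_def)
  then show ?thesis
    using prob_simplexD(2)[OF w] by (simp add: sum_subtractf flip: sum_distrib_right)
qed

lemma weighted_mean_le:
  fixes D :: "'n::finite \<Rightarrow> ereal"
  assumes w: "w \<in> prob_simplex" and D: "\<And>i. D i \<le> s"
  shows "(\<Sum>i\<in>UNIV. ereal (w $ i) * D i) \<le> s"
proof (cases s)
  case (real r)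
  have "(\<Sum>i\<in>UNIV. ereal (w $ i) * D i) \<le> (\<Sum>i\<in>UNIV. ereal (w $ i) * ereal r)"
    using D prob_simplexD(1)[OF w] real by (intro sum_mono ereal_mult_left_mono) auto
  then show ?thesis using prob_simplexD(2)[OF w] real by (simp flip: sum_distrib_right)
next
  case MInf
  have "\<exists>i. w $ i \<noteq> 0"
    using prob_simplexD(2)[OF w] by (metis sum.neutral zero_neq_one)
  then obtain i where "w $ i \<noteq> 0" by blast
  then have "0 < w $ i" using prob_simplexD(1)[OF w, of i] by simp
  moreover have D_eq: "D j = -\<infinity>" for j using D[of j] MInf by simp
  moreover have "ereal (w $ j) * D j \<noteq> \<infinity>" for j
    using prob_simplexD(1)[OF w, of j] by (cases "w $ j = 0") (auto simp: D_eq)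
  ultimately have "(\<Sum>i\<in>UNIV. ereal (w $ i) * D i) = -\<infinity>"
    by (intro sum_ereal_eq_MInfty[of UNIV i]) auto
  then show ?thesis by simp
qed simp

section \<open>The dual function and its saddle point\<close>

locale chain_family = product_states X \<pi> d m Xs Ss
  for X :: "'a state set" and \<pi> :: "'a state \<Rightarrow> real" and d m Xs Ss +
  fixes P :: "'n::finite \<Rightarrow> ('a state, real) matrix"
  assumes P_transition: "P i \<in> transition_matrices X"
begin

abbreviation (input) F where "F \<equiv> factorizable X \<pi> m Ss"
abbreviation (input) \<A> where "\<A> \<equiv> log_mixtures X F"

definition fit :: "real ^ 'n \<Rightarrow> ('a state, real) matrix" where
  "fit w = fp (mixture P w)"

text \<open>
  The finite value of the generalized divergence of \<open>P i\<close>, as a function of a real matrix \<open>a\<close> in the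
  place of \<open>A\<close>. It is affine in \<open>a\<close>, and \<open>a = 0\<close> gives the negative entropy term.
\<close>
definition divergence :: "'n \<Rightarrow> ('a state, real) matrix \<Rightarrow> real" where
  "divergence i a = (\<Sum>x\<in>X. \<Sum>y\<in>X. \<pi> x * P i x y * (ln (P i x y) - a x y))"

text \<open>
  The value \<open>\<Sum>\<^sub>i w\<^sub>i D\<^sub>i(log Q\<^sub>w)\<close> as a real number. Indices of weight \<open>0\<close> contribute nothing, also when
  their divergence is infinite and \<open>divergence\<close> returns a meaningless number.
\<close>
definition dual_value :: "real ^ 'n \<Rightarrow> real" where
  "dual_value w = (\<Sum>i\<in>UNIV. w $ i * divergence i (\<lambda>x y. ln (fit w x y)))"

lemma mixture_transition:
  assumes w: "w \<in> prob_simplex"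
  shows "mixture P w \<in> transition_matrices X"
proof -
  have "(\<Sum>y\<in>X. mixture P w x y) = 1" if x: "x \<in> X" for x
  proof -
    have "(\<Sum>y\<in>X. mixture P w x y) = (\<Sum>i\<in>UNIV. w $ i * (\<Sum>y\<in>X. P i x y))"
      unfolding mixture_def by (subst sum.swap) (simp add: sum_distrib_left)
    then show ?thesis
      by (simp add: transition_matricesD(2)[OF P_transition x] prob_simplexD[OF w])
  qed
  moreover have "0 \<le> mixture P w x y" if "x \<in> X" "y \<in> X" for x y
    unfolding mixture_def
    by (intro sum_nonneg mult_nonneg_nonneg prob_simplexD[OF w] transition_matricesD(1)[OF P_transition] that)
  ultimately show ?thesis by (simp add: transition_matrices_def)
qed

lemma fit_transition: "w \<in> prob_simplex \<Longrightarrow> fit w \<in> transition_matrices X"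
  unfolding fit_def by (intro factor_product_transition mixture_transition)

lemma fit_factorizable: "w \<in> prob_simplex \<Longrightarrow> fit w \<in> F"
  unfolding fit_def by (intro factor_product_factorizable mixture_transition)

lemma mixture_pos_iff:
  assumes w: "w \<in> prob_simplex" and xy: "x \<in> X" "y \<in> X"
  shows "0 < mixture P w x y \<longleftrightarrow> (\<exists>i. 0 < w $ i \<and> 0 < P i x y)"
proof -
  have nn: "0 \<le> w $ i" "0 \<le> P i x y" for i
    using prob_simplexD[OF w] transition_matricesD(1)[OF P_transition xy] by auto
  have "mixture P w x y = 0 \<longleftrightarrow> (\<forall>i. w $ i * P i x y = 0)"
    unfolding mixture_def by (subst sum_nonneg_eq_0_iff) (auto simp: nn)
  moreover have "0 \<le> mixture P w x y" by (simp add: mixture_def sum_nonneg nn)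
  ultimately show ?thesis using nn by (auto simp: less_le)
qed

lemma fit_pos:
  assumes "w \<in> prob_simplex" "x \<in> X" "y \<in> X" "0 < w $ i" "0 < P i x y"
  shows "0 < fit w x y"
  unfolding fit_def using assms
  by (intro factor_product_pos mixture_transition) (auto simp: mixture_pos_iff)

text \<open>
  The weighted sum splits into a part independent of \<open>a\<close> and a cross entropy in which the family
  enters through its mixture alone.
\<close>
lemma weighted_divergence:
  "(\<Sum>i\<in>UNIV. w $ i * divergence i a) =
   (\<Sum>i\<in>UNIV. w $ i * divergence i (\<lambda>x y. 0)) - (\<Sum>x\<in>X. \<Sum>y\<in>X. \<pi> x * mixture P w x y * a x y)"
proof -
  have "(\<Sum>x\<in>X. \<Sum>y\<in>X. \<pi> x * mixture P w x y * a x y) =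
        (\<Sum>x\<in>X. \<Sum>y\<in>X. \<Sum>i\<in>UNIV. w $ i * (\<pi> x * P i x y * a x y))"
    by (simp add: mixture_def sum_distrib_left sum_distrib_right mult_ac)
  also have "\<dots> = (\<Sum>i\<in>UNIV. w $ i * (\<Sum>x\<in>X. \<Sum>y\<in>X. \<pi> x * P i x y * a x y))"
    by (simp only: sum.swap[of _ X UNIV] sum_distrib_left)
  finally show ?thesis
    by (simp add: divergence_def right_diff_distrib sum_subtractf)
qed

lemma dual_value_le:
  assumes w: "w \<in> prob_simplex"
    and le: "(\<Sum>x\<in>X. \<Sum>y\<in>X. \<pi> x * mixture P w x y * a x y) \<le>
       (\<Sum>x\<in>X. \<Sum>y\<in>X. \<pi> x * mixture P w x y * ln (fit w x y))"
  shows "dual_value w \<le> (\<Sum>i\<in>UNIV. w $ i * divergence i a)"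
  unfolding dual_value_def weighted_divergence[of w a] weighted_divergence[of w "\<lambda>x y. ln (fit w x y)"]
  using le by simp

text \<open>
  The minimality of \<open>fit w\<close> in purely real form; concavity and the saddle point use it at a model
  fitted to different weights.
\<close>
lemma dual_value_le_factorizable:
  assumes w: "w \<in> prob_simplex" and R: "R \<in> F"
    and pos: "\<And>i x y. x \<in> X \<Longrightarrow> y \<in> X \<Longrightarrow> 0 < w $ i \<Longrightarrow> 0 < P i x y \<Longrightarrow> 0 < R x y"
  shows "dual_value w \<le> (\<Sum>i\<in>UNIV. w $ i * divergence i (\<lambda>x y. ln (R x y)))"
  by (rule dual_value_le[OF w], unfold fit_def,
      rule cross_entropy_factorizable_le[OF mixture_transition[OF w] R])
     (use pos in \<open>auto simp: mixture_pos_iff[OF w]\<close>)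

lemma gen_kl_div_eq_divergence:
  assumes "\<And>x y. x \<in> X \<Longrightarrow> y \<in> X \<Longrightarrow> 0 < P i x y \<Longrightarrow> A x y = ereal (a x y)"
  shows "gen_kl_div X \<pi> (P i) A = ereal (divergence i a)"
  unfolding divergence_def
proof (rule gen_kl_div_real)
  fix x y assume "x \<in> X" "y \<in> X" "P i x y \<noteq> 0"
  then show "A x y = ereal (a x y)"
    using assms[of x y] transition_matricesD(1)[OF P_transition, of x y i] by simp
qed

lemma gen_kl_div_cases:
  assumes A: "A \<in> \<A>"
  obtains (inf) x y where "x \<in> X" "y \<in> X" "0 < P i x y" "A x y = -\<infinity>" "gen_kl_div X \<pi> (P i) A = \<infinity>"
  | (fin) "\<And>x y. x \<in> X \<Longrightarrow> y \<in> X \<Longrightarrow> 0 < P i x y \<Longrightarrow> A x y \<noteq> -\<infinity>"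
      "gen_kl_div X \<pi> (P i) A = ereal (divergence i (\<lambda>x y. real_of_ereal (A x y)))"
proof (cases "\<exists>x\<in>X. \<exists>y\<in>X. 0 < P i x y \<and> A x y = -\<infinity>")
  case True
  then obtain x y where xy: "x \<in> X" "y \<in> X" "0 < P i x y" "A x y = -\<infinity>" by auto
  then have "gen_kl_div X \<pi> (P i) A = \<infinity>"
    by (intro gen_kl_div_infinite finite_X P_transition pi_pos log_mixture_not_PInfty[OF A])
  with xy show ?thesis by (rule inf)
next
  case False
  have "A x y = ereal (real_of_ereal (A x y))" if "x \<in> X" "y \<in> X" "0 < P i x y" for x y
    using False that log_mixture_not_PInfty[OF A that(1,2)] by (cases "A x y") auto
  then show ?thesis using False by (intro fin gen_kl_div_eq_divergence) auto
qed

lemma gen_kl_div_not_MInfty: "A \<in> \<A> \<Longrightarrow> gen_kl_div X \<pi> (P i) A \<noteq> -\<infinity>"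
  by (rule gen_kl_div_cases[of A i]) auto

text \<open>
  The lower bound that carries duality: \<open>opt_log\<close> minimizes the \<open>w\<close>-average of the divergences over
  all mixtures of logarithms. If the right-hand side is finite, \<open>A\<close> is finite on the support of the
  mixture and the claim is a comparison of cross entropies.
\<close>
lemma dual_value_le_weighted:
  assumes w: "w \<in> prob_simplex" and A: "A \<in> \<A>"
  shows "ereal (dual_value w) \<le> (\<Sum>i\<in>UNIV. ereal (w $ i) * gen_kl_div X \<pi> (P i) A)"
proof (cases "\<exists>i. 0 < w $ i \<and> gen_kl_div X \<pi> (P i) A = \<infinity>")
  case True
  then obtain i where "0 < w $ i" "gen_kl_div X \<pi> (P i) A = \<infinity>" by auto
  then have "(\<Sum>i\<in>UNIV. ereal (w $ i) * gen_kl_div X \<pi> (P i) A) = \<infinity>"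
    by (auto simp: sum_Pinfty intro!: exI[of _ i])
  then show ?thesis by simp
next
  case False
  let ?a = "\<lambda>x y. real_of_ereal (A x y)"
  have supp: "A x y \<noteq> -\<infinity>" if "0 < w $ i" "x \<in> X" "y \<in> X" "0 < P i x y" for i x y
    by (rule gen_kl_div_cases[OF A, of i]) (use False that in auto)
  have "ereal (w $ i) * gen_kl_div X \<pi> (P i) A = ereal (w $ i * divergence i ?a)" for i
  proof (cases "w $ i = 0")
    case False
    then have "0 < w $ i" using prob_simplexD(1)[OF w, of i] by simp
    with \<open>\<nexists>i. _ i\<close> show ?thesis by (cases rule: gen_kl_div_cases[OF A, of i]) auto
  qed (simp flip: zero_ereal_def)
  moreover have "dual_value w \<le> (\<Sum>i\<in>UNIV. w $ i * divergence i ?a)"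
  proof (rule dual_value_le[OF w], rule cross_entropy_log_mixture_le[OF finite_X mixture_transition[OF w] A])
    show "A x y \<noteq> -\<infinity>" if "x \<in> X" "y \<in> X" "0 < mixture P w x y" for x y
      using that supp by (auto simp: mixture_pos_iff[OF w])
    show "F \<subseteq> transition_matrices X" by (auto simp: factorizable_def)
    show "(\<Sum>x\<in>X. \<Sum>y\<in>X. \<pi> x * mixture P w x y * ln (R x y)) \<le>
        (\<Sum>x\<in>X. \<Sum>y\<in>X. \<pi> x * mixture P w x y * ln (fit w x y))"
      if "R \<in> F" "\<And>x y. x \<in> X \<Longrightarrow> y \<in> X \<Longrightarrow> 0 < mixture P w x y \<Longrightarrow> 0 < R x y" for R
      unfolding fit_def by (intro cross_entropy_factorizable_le mixture_transition w that)
  qed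
  ultimately show ?thesis by simp
qed

lemma opt_log_eq: "opt_log X \<pi> m Ss P w = (\<lambda>x y. elog (fit w x y))"
  by (simp add: opt_log_def fit_def)

lemma opt_log_log_mixture: "w \<in> prob_simplex \<Longrightarrow> opt_log X \<pi> m Ss P w \<in> \<A>"
  unfolding opt_log_eq by (intro elog_in_log_mixtures fit_factorizable)

lemma gen_kl_div_opt_log:
  assumes "\<And>x y. x \<in> X \<Longrightarrow> y \<in> X \<Longrightarrow> 0 < P i x y \<Longrightarrow> 0 < fit w x y"
  shows "gen_kl_div X \<pi> (P i) (opt_log X \<pi> m Ss P w) = ereal (divergence i (\<lambda>x y. ln (fit w x y)))"
  using assms by (intro gen_kl_div_eq_divergence) (fastforce simp: opt_log_eq elog_def)

lemma weighted_gen_kl_eq: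
  assumes w: "w \<in> prob_simplex"
  shows "weighted_gen_kl X \<pi> m Ss P w = ereal (dual_value w)"
proof -
  have "ereal (w $ i) * gen_kl_div X \<pi> (P i) (opt_log X \<pi> m Ss P w) =
     ereal (w $ i * divergence i (\<lambda>x y. ln (fit w x y)))" for i
  proof (cases "w $ i = 0")
    case False
    then have "0 < w $ i" using prob_simplexD(1)[OF w, of i] by simp
    then show ?thesis using fit_pos[OF w] by (subst gen_kl_div_opt_log) auto
  qed (simp flip: zero_ereal_def)
  then show ?thesis by (simp add: weighted_gen_kl_def dual_value_def)
qed

lemma kl_div_factorizable_eq:
  assumes "R \<in> F"
  shows "kl_div X \<pi> (P i) R = gen_kl_div X \<pi> (P i) (\<lambda>x y. elog (R x y))"
  using assms by (intro kl_div_eq_gen_kl_div finite_X P_transition pi_pos) (simp_all add: factorizable_def)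

lemma weighted_kl_eq:
  assumes w: "w \<in> prob_simplex"
  shows "weighted_kl X \<pi> m Ss P w = ereal (dual_value w)"
  unfolding weighted_gen_kl_eq[OF w, symmetric] weighted_kl_def weighted_gen_kl_def opt_log_eq
  using kl_div_factorizable_eq[OF fit_factorizable[OF w]] by (simp add: fit_def)

text \<open>
  Gibbs' inequality for \<open>P i\<close> and \<open>fit w\<close>. The dual value is thereby an admissible \<open>r\<close> in the
  primal problem.
\<close>
lemma dual_value_nonneg:
  assumes w: "w \<in> prob_simplex"
  shows "0 \<le> dual_value w"
  unfolding dual_value_def
proof (intro sum_nonneg)
  fix i
  show "0 \<le> w $ i * divergence i (\<lambda>x y. ln (fit w x y))"
  proof (cases "w $ i = 0")
    case False
    then have i: "0 < w $ i" using prob_simplexD(1)[OF w, of i] by simp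
    have "(\<Sum>x\<in>X. \<Sum>y\<in>X. \<pi> x * P i x y * ln (fit w x y)) \<le> (\<Sum>x\<in>X. \<Sum>y\<in>X. \<pi> x * P i x y * ln (P i x y))"
      by (rule gibbs_transition[OF finite_X P_transition fit_transition[OF w]])
         (auto simp: pi_pos less_imp_le zero_less_mult_iff dest: pi_pos intro!: fit_pos[OF w _ _ i])
    then show ?thesis using i
      by (simp add: divergence_def right_diff_distrib sum_subtractf)
  qed simp
qed

text \<open>
  Both endpoints are compared with the single model fitted at the intermediate point \<open>z\<close>. At that
  model the weighted divergence is linear in the weights and equals the dual value at \<open>z\<close>.
\<close>
lemma concave_dual_value: "concave_on prob_simplex dual_value"
proof -
  have "(1 - t) * dual_value w + t * dual_value u \<le> dual_value ((1 - t) *\<^sub>R w + t *\<^sub>R u)"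
    if t: "0 < t" "t < 1" and w: "w \<in> prob_simplex" and u: "u \<in> prob_simplex" for t w u
  proof -
    let ?z = "(1 - t) *\<^sub>R w + t *\<^sub>R u"
    let ?d = "\<lambda>i. divergence i (\<lambda>x y. ln (fit ?z x y))"
    have z: "?z \<in> prob_simplex" using segment_in_simplex[OF w u] t by simp
    have "dual_value w \<le> (\<Sum>i\<in>UNIV. w $ i * ?d i)"
      by (intro dual_value_le_factorizable w fit_factorizable z fit_pos[OF z] segment_pos[OF w u t] disjI1)
    moreover have "dual_value u \<le> (\<Sum>i\<in>UNIV. u $ i * ?d i)"
      by (intro dual_value_le_factorizable u fit_factorizable z fit_pos[OF z] segment_pos[OF w u t] disjI2)
    ultimately have "(1 - t) * dual_value w + t * dual_value u \<le>
        (1 - t) * (\<Sum>i\<in>UNIV. w $ i * ?d i) + t * (\<Sum>i\<in>UNIV. u $ i * ?d i)"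
      using t by (intro add_mono mult_left_mono) auto
    also have "\<dots> = dual_value ?z"
      unfolding dual_value_def by (rule sum_segment_weights[symmetric])
    finally show ?thesis .
  qed
  then show ?thesis
    unfolding concave_on_def using convex_prob_simplex
    by (intro convex_onI) (auto simp: algebra_simps)
qed

lemma continuous_keep_in_mixture: "continuous_on U (\<lambda>w. keep_in X \<pi> S (mixture P w) u v)"
  unfolding keep_in_def mixture_def divide_inverse by (intro continuous_intros)

lemma continuous_Q: "continuous_on U (\<lambda>w. fit w x y)"
  unfolding fit_def factor_product_def tensor_def
  by (intro continuous_on_prod continuous_keep_in_mixture)

text \<open>
  Written block by block, \<open>dual_value\<close> is a linear function minus a combination of values of
  \<open>t ln t\<close> at marginals of the mixture, so it stays continuous where marginals vanish and \<open>ln\<close> itself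
  does not.
\<close>
lemma continuous_dual_value: "continuous_on prob_simplex dual_value"
proof -
  let ?k = "\<lambda>j w u v. keep_in X \<pi> (Ss j) (mixture P w) u v"
  have eq: "dual_value w = (\<Sum>i\<in>UNIV. w $ i * divergence i (\<lambda>x y. 0)) -
      (\<Sum>j=1..m. \<Sum>u\<in>block_states (Ss j). \<Sum>v\<in>block_states (Ss j). marginal (Ss j) u * (?k j w u v * ln (?k j w u v)))"
    if w: "w \<in> prob_simplex" for w
  proof -
    have "(\<Sum>x\<in>X. \<Sum>y\<in>X. \<pi> x * mixture P w x y * ln (fit w x y)) =
        (\<Sum>j=1..m. \<Sum>u\<in>block_states (Ss j). \<Sum>v\<in>block_states (Ss j). marginal (Ss j) u * ?k j w u v * ln (?k j w u v))"
      unfolding fit_def factor_product_def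
      by (intro cross_entropy_tensor mixture_transition w keep_in_pos)
    then show ?thesis
      unfolding dual_value_def weighted_divergence[of w "\<lambda>x y. ln (fit w x y)"]
      by (simp add: mult.assoc)
  qed
  have phi: "continuous_on prob_simplex (\<lambda>w. ?k j w u v * ln (?k j w u v))"
    if "u \<in> block_states (Ss j)" "v \<in> block_states (Ss j)" for j u v
    using transition_matricesD(1)[OF keep_in_transition[OF mixture_transition] that]
    by (intro continuous_on_compose2[OF continuous_on_mult_ln continuous_keep_in_mixture]) auto
  show ?thesis
    by (subst continuous_on_cong[OF refl eq])
       (auto intro!: continuous_on_diff continuous_on_sum continuous_on_mult_left
         continuous_on_mult_right continuous_on_component continuous_on_id phi)
qed

text \<open>
  Lower semicontinuity of the divergence along a segment ending at \<open>w\<close>. The bound \<open>c\<close> forces each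
  entry of the fitted models on the support of \<open>P i\<close> to stay away from \<open>0\<close>, as no term
  \<open>-ln (fit z x y)\<close> is negative and so none of them can be large. The limit model is therefore
  positive there, and the divergence is continuous along the segment.
\<close>
lemma divergence_limit:
  assumes w: "w \<in> prob_simplex"
    and approx: "\<And>t. 0 < t \<Longrightarrow> t < 1 \<Longrightarrow>
       divergence i (\<lambda>x y. ln (fit ((1 - t) *\<^sub>R w + t *\<^sub>R axis i 1) x y)) \<le> c"
  shows "(\<forall>x\<in>X. \<forall>y\<in>X. 0 < P i x y \<longrightarrow> 0 < fit w x y) \<and> divergence i (\<lambda>x y. ln (fit w x y)) \<le> c"
proof -
  \<comment> \<open>any sequence in \<open>(0, 1)\<close> tending to \<open>0\<close> would do\<close>
  define t where "t n = 1 / (real n + 2)" for n :: nat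
  define z where "z n = (1 - t n) *\<^sub>R w + t n *\<^sub>R axis i 1" for n
  have t: "0 < t n" "t n < 1" for n by (auto simp: t_def)
  have tl: "t \<longlonglongrightarrow> 0" unfolding t_def by real_asymp
  have zs: "z n \<in> prob_simplex" for n
    unfolding z_def using t[of n] by (intro segment_in_simplex w axis_in_prob_simplex) auto
  have "z \<longlonglongrightarrow> (1 - 0) *\<^sub>R w + 0 *\<^sub>R axis i 1"
    unfolding z_def by (intro tendsto_intros tl)
  then have zl: "z \<longlonglongrightarrow> w" by simp
  have Ql: "(\<lambda>n. fit (z n) x y) \<longlonglongrightarrow> fit w x y" for x y
    using continuous_on_tendsto_compose[OF continuous_Q[of UNIV x y] zl] by simp
  have zi: "0 < z n $ i" for n
    unfolding z_def by (intro segment_pos w axis_in_prob_simplex t) (simp add: axis_def)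
  have le: "divergence i (\<lambda>x y. ln (fit (z n) x y)) \<le> c" for n
    unfolding z_def by (intro approx t)
  let ?H = "divergence i (\<lambda>x y. 0)"
  have split: "divergence i a = ?H + (\<Sum>x\<in>X. \<Sum>y\<in>X. \<pi> x * P i x y * - a x y)" for a
    by (simp add: divergence_def right_diff_distrib sum_subtractf sum_negf)
  have pos: "0 < fit w x y" if xy: "x \<in> X" "y \<in> X" "0 < P i x y" for x y
  proof -
    let ?p = "\<pi> x * P i x y"
    have p: "0 < ?p" using pi_pos xy by simp
    have "exp (- ((c - ?H) / ?p)) \<le> fit (z n) x y" for n
    proof -
      have nn: "0 \<le> \<pi> x * P i x y * - ln (fit (z n) x y)" if "x \<in> X" "y \<in> X" for x y
        using transition_matricesD(1)[OF P_transition that, of i]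
          fit_pos[OF zs that zi] transition_matrix_le_1[OF fit_transition[OF zs] finite_X that] pi_pos[OF that(1)]
        by (cases "P i x y = 0") (auto intro!: mult_nonneg_nonpos)
      have "?p * - ln (fit (z n) x y) \<le> (\<Sum>y\<in>X. \<pi> x * P i x y * - ln (fit (z n) x y))"
        using xy finite_X nn by (intro member_le_sum[of y X "\<lambda>y. \<pi> x * P i x y * - ln (fit (z n) x y)"]) auto
      also have "\<dots> \<le> (\<Sum>x\<in>X. \<Sum>y\<in>X. \<pi> x * P i x y * - ln (fit (z n) x y))"
        using xy finite_X nn
        by (intro member_le_sum[of x X "\<lambda>x. \<Sum>y\<in>X. \<pi> x * P i x y * - ln (fit (z n) x y)"] sum_nonneg) auto
      also have "\<dots> \<le> c - ?H" using le[of n] unfolding split[of "\<lambda>x y. ln (fit (z n) x y)"] by simp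
      finally have "- ((c - ?H) / ?p) \<le> ln (fit (z n) x y)"
        using p by (simp add: field_simps)
      then show ?thesis using fit_pos[OF zs xy(1,2) zi xy(3)] by (simp add: ln_ge_iff)
    qed
    then have "exp (- ((c - ?H) / ?p)) \<le> fit w x y"
      by (intro LIMSEQ_le_const[OF Ql]) auto
    then show ?thesis using exp_gt_zero less_le_trans by blast
  qed
  have "(\<lambda>n. \<pi> x * P i x y * (ln (P i x y) - ln (fit (z n) x y))) \<longlonglongrightarrow>
        \<pi> x * P i x y * (ln (P i x y) - ln (fit w x y))" if "x \<in> X" "y \<in> X" for x y
    using pos[OF that] transition_matricesD(1)[OF P_transition that, of i]
    by (cases "P i x y = 0") (auto intro!: tendsto_intros Ql)
  then have "(\<lambda>n. divergence i (\<lambda>x y. ln (fit (z n) x y))) \<longlonglongrightarrow> divergence i (\<lambda>x y. ln (fit w x y))"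
    unfolding divergence_def by (intro tendsto_sum)
  then have "divergence i (\<lambda>x y. ln (fit w x y)) \<le> c"
    using le by (intro LIMSEQ_le_const2) auto
  with pos show ?thesis by blast
qed

text \<open>
  A maximizer \<open>w\<close> of the dual value satisfies the primal constraints. Moving towards the vertex
  \<open>axis i 1\<close> cannot increase the dual value, while the model fitted at the new point is no better than
  \<open>fit w\<close> for the old weights; the difference bounds the divergence of \<open>P i\<close>.
\<close>
lemma saddle_point:
  obtains w where "w \<in> prob_simplex"
    "\<And>u. u \<in> prob_simplex \<Longrightarrow> dual_value u \<le> dual_value w"
    "\<And>i. gen_kl_div X \<pi> (P i) (opt_log X \<pi> m Ss P w) \<le> ereal (dual_value w)"
proof -
  have "\<exists>w\<in>prob_simplex. \<forall>u\<in>prob_simplex. dual_value u \<le> dual_value w"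
    using axis_in_prob_simplex
    by (intro continuous_attains_sup compact_prob_simplex continuous_dual_value) auto
  then obtain w where w: "w \<in> prob_simplex"
    and max: "\<And>u. u \<in> prob_simplex \<Longrightarrow> dual_value u \<le> dual_value w" by blast
  have "gen_kl_div X \<pi> (P i) (opt_log X \<pi> m Ss P w) \<le> ereal (dual_value w)" for i
  proof -
    have "divergence i (\<lambda>x y. ln (fit ((1 - t) *\<^sub>R w + t *\<^sub>R axis i 1) x y)) \<le> dual_value w"
      if t: "0 < t" "t < 1" for t
    proof -
      let ?z = "(1 - t) *\<^sub>R w + t *\<^sub>R axis i 1"
      let ?d = "\<lambda>k. divergence k (\<lambda>x y. ln (fit ?z x y))"
      have z: "?z \<in> prob_simplex"
        using segment_in_simplex[OF w axis_in_prob_simplex] t by simp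
      have "dual_value w \<le> (\<Sum>k\<in>UNIV. w $ k * ?d k)"
        by (intro dual_value_le_factorizable w fit_factorizable z fit_pos[OF z]
            segment_pos[OF w axis_in_prob_simplex t] disjI1)
      then have "(1 - t) * dual_value w + t * ?d i \<le>
          (1 - t) * (\<Sum>k\<in>UNIV. w $ k * ?d k) + t * (\<Sum>k\<in>UNIV. axis i 1 $ k * ?d k)"
        using t by (simp add: sum_axis_mult)
      also have "\<dots> = dual_value ?z"
        unfolding dual_value_def by (rule sum_segment_weights[symmetric])
      also have "\<dots> \<le> dual_value w" by (rule max[OF z])
      finally have "t * ?d i \<le> t * dual_value w" by (simp add: algebra_simps)
      then show ?thesis using t by simp
    qed
    from divergence_limit[OF w this]
    show ?thesis by (subst gen_kl_div_opt_log) auto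
  qed
  with w max show ?thesis by (rule that)
qed

end

section \<open>Strong duality\<close>

lemma is_min_valueI:
  assumes "b \<in> D" "f b \<le> c" "\<And>x. x \<in> D \<Longrightarrow> c \<le> f x"
  shows "is_min_value f D c"
  unfolding is_min_value_def is_arg_min_linorder
  using assms by (intro exI[of _ b]) (auto intro: antisym order_trans)

lemma is_max_valueI:
  assumes "b \<in> D" "c \<le> f b" "\<And>x. x \<in> D \<Longrightarrow> f x \<le> c"
  shows "is_max_value f D c"
  unfolding is_max_value_def is_arg_max_linorder
  using assms by (intro exI[of _ b]) (auto intro: antisym order_trans)

lemma le_MAX_range:
  fixes P :: "'n::finite \<Rightarrow> 'm" and g :: "'m \<Rightarrow> 'c::linorder"
  shows "g (P i) \<le> (MAX M\<in>range P. g M)"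
  by (rule Max_ge) auto

lemma MAX_range_le_iff:
  fixes P :: "'n::finite \<Rightarrow> 'm" and g :: "'m \<Rightarrow> 'c::linorder"
  shows "(MAX M\<in>range P. g M) \<le> c \<longleftrightarrow> (\<forall>i. g (P i) \<le> c)"
  by (subst Max_le_iff) auto

theorem theorem3p2:
  fixes d m :: nat
    and Xs :: "nat \<Rightarrow> 'a set"
    and X :: "'a state set"
    and \<pi> :: "'a state \<Rightarrow> real"
    and P :: "'n::finite \<Rightarrow> ('a state, real) matrix"
    and Ss :: "nat \<Rightarrow> nat set"
    and F :: "('a state, real) matrix set"
    and \<A> :: "('a state, ereal) matrix set"
  assumes "\<And>i. i \<in> {1..d} \<Longrightarrow> finite (Xs i)"
    and "X = Pi\<^sub>E {1..d} Xs"
    and "\<pi> \<in> full_support_pmfs X"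
    and "\<And>i. P i \<in> transition_matrices X"
    and "\<And>i. stationary X \<pi> (P i)"
    and "partition_on {1..d} (Ss ` {1..m})" and "inj_on Ss {1..m}"
    and "F = factorizable X \<pi> m Ss"
    and "\<A> = log_mixtures X F"
  shows
    "(\<exists>v::ereal.
        \<comment> \<open>item 1\<close>
        is_min_value (\<lambda>(A, r). ereal r) (primal_feasible X \<pi> P \<A>) v \<and>
        is_max_value (dual_fun X \<pi> P \<A>) nonneg_vectors v \<and>
        is_min_value (\<lambda>A. MAX M\<in>range P. gen_kl_div X \<pi> M A) \<A> v \<and>
        is_max_value (weighted_gen_kl X \<pi> m Ss P) prob_simplex v \<and>
        (\<exists>w\<in>prob_simplex. weighted_gen_kl X \<pi> m Ss P w = v) \<and>
        \<comment> \<open>item 3\<close>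
        is_min_value (\<lambda>Q. MAX M\<in>range P. kl_div X \<pi> M Q) F v \<and>
        \<comment> \<open>item 4\<close>
        is_max_value (weighted_kl X \<pi> m Ss P) prob_simplex v \<and>
        (\<forall>w\<in>prob_simplex. weighted_gen_kl X \<pi> m Ss P w = v \<longrightarrow> weighted_kl X \<pi> m Ss P w = v))
     \<and>
     \<comment> \<open>item 2\<close>
     (\<forall>A r w.
        is_arg_min snd (\<lambda>z. z \<in> primal_feasible X \<pi> P \<A>) (A, r) \<and>
        w \<in> prob_simplex \<and> is_arg_max (dual_fun X \<pi> P \<A>) (\<lambda>u. u \<in> nonneg_vectors) w \<longrightarrow>
        (\<forall>i. (w $ i > 0 \<longrightarrow> gen_kl_div X \<pi> (P i) A = ereal r) \<and>
             (w $ i = 0 \<longrightarrow> gen_kl_div X \<pi> (P i) A \<le> ereal r)))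
     \<and>
     \<comment> \<open>item 5; real-valuedness of the map is part of the claim\<close>
     ((\<forall>w\<in>prob_simplex. \<bar>weighted_kl X \<pi> m Ss P w\<bar> \<noteq> \<infinity>) \<and>
      concave_on prob_simplex (\<lambda>w. real_of_ereal (weighted_kl X \<pi> m Ss P w)))"
proof -
  have "finite X" unfolding assms(2) using assms(1) by (intro finite_PiE) auto
  then interpret chain_family X \<pi> d m Xs Ss P
    using assms by unfold_locales auto
  note F = assms(8)
  have \<A>: "\<A> = log_mixtures X (factorizable X \<pi> m Ss)" using assms(8,9) by simp
  let ?D = "\<lambda>i A. gen_kl_div X \<pi> (P i) A"
  obtain w where w: "w \<in> prob_simplex"
    and max: "\<And>u. u \<in> prob_simplex \<Longrightarrow> dual_value u \<le> dual_value w"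
    and sat: "\<And>i. ?D i (opt_log X \<pi> m Ss P w) \<le> ereal (dual_value w)"
    using saddle_point by metis
  define c where "c = dual_value w"
  define A0 where "A0 = opt_log X \<pi> m Ss P w"
  have c0: "0 \<le> c" unfolding c_def by (rule dual_value_nonneg[OF w])
  have A0: "A0 \<in> \<A>" unfolding A0_def \<A> by (rule opt_log_log_mixture[OF w])
  have A0c: "?D i A0 \<le> ereal c" for i unfolding A0_def c_def by (rule sat)
  have weighted: "ereal c \<le> (\<Sum>i\<in>UNIV. ereal (w $ i) * ?D i A)" if "A \<in> \<A>" for A
    unfolding c_def using that by (intro dual_value_le_weighted w) (simp add: \<A>)
  have DM: "?D i A \<noteq> -\<infinity>" if "A \<in> \<A>" for i A
    using that by (intro gen_kl_div_not_MInfty) (simp add: \<A>)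
  \<comment> \<open>a maximum is at least the \<open>w\<close>-average\<close>
  have lower: "ereal c \<le> s" if "A \<in> \<A>" "\<And>i. ?D i A \<le> s" for A s
    using weighted[OF that(1)] weighted_mean_le[OF w that(2)] by (rule order_trans)
  have feas0: "(A0, c) \<in> primal_feasible X \<pi> P \<A>"
    using A0 A0c c0 by (simp add: primal_feasible_def)
  have feas_le: "c \<le> r" if "(A, r) \<in> primal_feasible X \<pi> P \<A>" for A r
    using lower[of A "ereal r"] that by (auto simp: primal_feasible_def)
  have primal: "is_min_value (\<lambda>(A, r). ereal r) (primal_feasible X \<pi> P \<A>) (ereal c)"
    using feas0 feas_le by (intro is_min_valueI[of "(A0, c)"]) auto

  have dual_le: "dual_fun X \<pi> P \<A> u \<le> lagrangian X \<pi> P r A u" if "A \<in> \<A>" "0 \<le> r" for u A r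
    unfolding dual_fun_def using that by (intro INF_lower2[of "(r, A)"]) auto
  \<comment> \<open>weak duality, for multipliers that need not sum to \<open>1\<close>\<close>
  have slack: "lagrangian X \<pi> P c A u \<le> ereal c"
    if "A \<in> \<A>" "\<And>i. ?D i A \<le> ereal c" "u \<in> nonneg_vectors" for A u
  proof -
    have "ereal (u $ i) * (?D i A - ereal c) \<le> 0" for i
      using that(3) ereal_mult_left_mono[of "?D i A - ereal c" 0 "ereal (u $ i)"] that(2)[of i]
      by (simp add: nonneg_vectors_def ereal_minus_le_iff)
    then have "(\<Sum>i\<in>UNIV. ereal (u $ i) * (?D i A - ereal c)) \<le> 0"
      by (intro sum_nonpos)
    from add_left_mono[OF this, of "ereal c"] show ?thesis by (simp add: lagrangian_def)
  qed
  have dual_upper: "dual_fun X \<pi> P \<A> u \<le> ereal c" if "u \<in> nonneg_vectors" for u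
    using dual_le[OF A0 c0] slack[OF A0 A0c that] by (rule order_trans)
  have "ereal c \<le> dual_fun X \<pi> P \<A> w"
    unfolding dual_fun_def
  proof (intro INF_greatest, clarsimp)
    fix r A assume "A \<in> \<A>"
    then show "ereal c \<le> lagrangian X \<pi> P r A w"
      unfolding lagrangian_def by (subst lagrangian_simplex[OF w DM]) (auto intro: weighted)
  qed
  with dual_upper have w_dual: "dual_fun X \<pi> P \<A> w = ereal c"
    using prob_simplexD[OF w] by (intro antisym) (auto simp: nonneg_vectors_def)
  have w_nonneg: "w \<in> nonneg_vectors" using prob_simplexD[OF w] by (simp add: nonneg_vectors_def)
  have dual: "is_max_value (dual_fun X \<pi> P \<A>) nonneg_vectors (ereal c)"
    using w_dual w_nonneg dual_upper by (intro is_max_valueI[of w]) auto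

  have min_A: "is_min_value (\<lambda>A. MAX M\<in>range P. gen_kl_div X \<pi> M A) \<A> (ereal c)"
  proof (rule is_min_valueI)
    show "(MAX M\<in>range P. gen_kl_div X \<pi> M A0) \<le> ereal c"
      using A0c by (simp add: MAX_range_le_iff)
    show "ereal c \<le> (MAX M\<in>range P. gen_kl_div X \<pi> M A)" if "A \<in> \<A>" for A
      by (rule lower[OF that]) (simp add: le_MAX_range)
  qed (rule A0)
  have min_F: "is_min_value (\<lambda>Q. MAX M\<in>range P. kl_div X \<pi> M Q) F (ereal c)"
  proof (rule is_min_valueI)
    have kl: "kl_div X \<pi> (P i) R = ?D i (\<lambda>x y. elog (R x y))" if "R \<in> F" for i R
      using that by (simp add: F kl_div_factorizable_eq)
    show Q: "fit w \<in> F" unfolding F by (rule fit_factorizable[OF w])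
    show "(MAX M\<in>range P. kl_div X \<pi> M (fit w)) \<le> ereal c"
      using A0c by (simp add: MAX_range_le_iff kl[OF Q] A0_def opt_log_eq)
    show "ereal c \<le> (MAX M\<in>range P. kl_div X \<pi> M R)" if "R \<in> F" for R
    proof (rule lower)
      show "(\<lambda>x y. elog (R x y)) \<in> \<A>"
        using that by (simp add: \<A> F elog_in_log_mixtures)
      show "?D i (\<lambda>x y. elog (R x y)) \<le> (MAX M\<in>range P. kl_div X \<pi> M R)" for i
        unfolding kl[OF that, symmetric] by (rule le_MAX_range)
    qed
  qed
  have max_gen: "is_max_value (weighted_gen_kl X \<pi> m Ss P) prob_simplex (ereal c)"
    and max_kl: "is_max_value (weighted_kl X \<pi> m Ss P) prob_simplex (ereal c)"
    using w max by (auto simp: weighted_gen_kl_eq weighted_kl_eq c_def intro!: is_max_valueI[of w])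

  have slackness: "(u $ i > 0 \<longrightarrow> ?D i A = ereal r) \<and> (u $ i = 0 \<longrightarrow> ?D i A \<le> ereal r)"
    if min: "is_arg_min snd (\<lambda>z. z \<in> primal_feasible X \<pi> P \<A>) (A, r)"
      and u: "u \<in> prob_simplex" and umax: "is_arg_max (dual_fun X \<pi> P \<A>) (\<lambda>u. u \<in> nonneg_vectors) u"
    for A r u i
  proof -
    have feas: "(A, r) \<in> primal_feasible X \<pi> P \<A>" and "r \<le> c"
      using min feas0 by (auto simp: is_arg_min_linorder)
    with feas_le have r: "r = c" by (simp add: antisym)
    have A: "A \<in> \<A>" and Ac: "\<And>i. ?D i A \<le> ereal c" using feas r by (auto simp: primal_feasible_def)
    have "ereal c \<le> dual_fun X \<pi> P \<A> u"
      using umax w_nonneg w_dual by (auto simp: is_arg_max_linorder)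
    also have "\<dots> \<le> lagrangian X \<pi> P c A u" by (rule dual_le[OF A c0])
    also have "\<dots> = (\<Sum>i\<in>UNIV. ereal (u $ i) * ?D i A)"
      unfolding lagrangian_def by (rule lagrangian_simplex[OF u DM[OF A]])
    finally have le: "ereal c \<le> (\<Sum>i\<in>UNIV. ereal (u $ i) * ?D i A)" .
    define e where "e i = real_of_ereal (?D i A)" for i
    have e: "?D i A = ereal (e i)" for i
      using DM[OF A, of i] Ac[of i] unfolding e_def by (cases "?D i A") auto
    have ec: "e i \<le> c" for i using Ac[of i] by (simp add: e)
    have "c \<le> (\<Sum>i\<in>UNIV. u $ i * e i)" using le by (simp add: e)
    then have "(\<Sum>i\<in>UNIV. u $ i * (c - e i)) \<le> 0"
      by (simp add: right_diff_distrib sum_subtractf prob_simplexD(2)[OF u] flip: sum_distrib_right)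
    moreover have nn: "0 \<le> u $ i * (c - e i)" for i
      using prob_simplexD(1)[OF u] ec by simp
    \<comment> \<open>nonnegative terms with a nonpositive sum vanish\<close>
    ultimately have "u $ i * (c - e i) = 0"
      using sum_nonneg_eq_0_iff[of UNIV "\<lambda>i. u $ i * (c - e i)"]
      by (simp add: antisym sum_nonneg)
    then show ?thesis using ec by (auto simp: e r)
  qed

  have concave: "concave_on prob_simplex (\<lambda>w. real_of_ereal (weighted_kl X \<pi> m Ss P w))"
    using concave_dual_value convexD[OF convex_prob_simplex[where 'n = 'n]]
    unfolding concave_on_iff by (auto simp: weighted_kl_eq)

  show ?thesis
    using primal dual min_A max_gen min_F max_kl w slackness concave
    by (intro conjI exI[of _ "ereal c"] bexI[of _ w])
       (auto simp: weighted_gen_kl_eq weighted_kl_eq c_def)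
qed

end
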